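(* Let $F=L-N:X\to Y$ satisfy hypothesis (H). Then for each $t\in\mathbb{R}$ the map $PF_t: H_X\to H_Y$, $PF_t(w)=P F(w+t\phi_p)$, is a bi-Lipschitz homeomorphism, and the Lipschitz constants of $PF_t$ and of $(PF_t)^{-1}$ can be chosen independent of $t$. Moreover, if $F$ is of class $C^k$ ($k\ge 1$), then each $PF_t$ is a $C^k$ diffeomorphism.
   Context: Let $X,Y$ be real Hilbert spaces, $X$ densely included in $Y$, and let $L:X\subset Y\to Y$ be a self-adjoint operator, $X$ carrying the graph norm $\|x\|_X=\|x\|_Y+\|Lx\|_Y$. Let $\lambda_p$ be a simple isolated eigenvalue of $L$ with eigenvector $\phi_p\in X$, $\|\phi_p\|_Y=1$. Let $V_X=V_Y=\langle\phi_p\rangle$ be its real span, $H_Y=\{y\in Y:\langle y,\phi_p\rangle_Y=0\}$, $H_X=X\cap H_Y$, so $X=H_X\oplus V_X$, $Y=H_Y\oplus V_Y$, and let $P:Y\to H_Y$ be the orthogonal projection. Let $N:Y\to Y$ and $F=L-N:X\to Y$. For $t\in\mathbb{R}$ define $PN_t:H_Y\to H_Y$, $PN_t(w)=PN(w+t\phi_p)$. Hypothesis (H): there is $n\ge 0$ such that every $PN_t$, $t\in\mathbb{R}$, is Lipschitz with constant $n$ (independent of $t$), and $[-n,n]\cap\sigma(L)=\{\lambda_p\}$. *)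

theory Defs
  imports "HOL-Analysis.Analysis"
begin

text \<open>The space X is modelled as the domain D, a subset of the Hilbert space Y (a type of
class real_inner and complete_space); L is only relevant on D.\<close>

definition linear_on_dom :: "'a::real_vector set \<Rightarrow> ('a \<Rightarrow> 'b::real_vector) \<Rightarrow> bool" where
  "linear_on_dom D L \<longleftrightarrow> subspace D \<and>
     (\<forall>x\<in>D. \<forall>y\<in>D. L (x + y) = L x + L y) \<and> (\<forall>c. \<forall>x\<in>D. L (c *\<^sub>R x) = c *\<^sub>R L x)"

text \<open>Self-adjoint (unbounded, densely defined) operator: L = L*, i.e. L is symmetric and the
domain of the adjoint equals D.\<close>
definition self_adjoint_op :: "'a::real_inner set \<Rightarrow> ('a \<Rightarrow> 'a) \<Rightarrow> bool" where
  "self_adjoint_op D L \<longleftrightarrow> linear_on_dom D L \<and> closure D = UNIV \<and>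
     (\<forall>x\<in>D. \<forall>y\<in>D. inner (L x) y = inner x (L y)) \<and>
     {y. \<exists>z. \<forall>x\<in>D. inner (L x) y = inner x z} = D"

definition spectrum_op :: "'a::real_normed_vector set \<Rightarrow> ('a \<Rightarrow> 'a) \<Rightarrow> real set" where
  "spectrum_op D L = {mu. \<not> (bij_betw (\<lambda>x. L x - mu *\<^sub>R x) D UNIV \<and>
       (\<exists>C. \<forall>x\<in>D. norm x \<le> C * norm (L x - mu *\<^sub>R x)))}"

definition simple_isolated_eigenvalue ::
  "'a::real_normed_vector set \<Rightarrow> ('a \<Rightarrow> 'a) \<Rightarrow> real \<Rightarrow> 'a \<Rightarrow> bool" where
  "simple_isolated_eigenvalue D L lam phi \<longleftrightarrow>
     phi \<in> D \<and> norm phi = 1 \<and> L phi = lam *\<^sub>R phi \<and>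
     {x\<in>D. L x = lam *\<^sub>R x} = span {phi} \<and>
     lam \<in> spectrum_op D L \<and>
     (\<exists>\<epsilon>>0. spectrum_op D L \<inter> {lam - \<epsilon> <..< lam + \<epsilon>} = {lam})"

definition graph_norm :: "('a::real_normed_vector \<Rightarrow> 'a) \<Rightarrow> 'a \<Rightarrow> real" where
  "graph_norm L x = norm x + norm (L x)"

definition proj_perp :: "'a::real_inner \<Rightarrow> 'a \<Rightarrow> 'a" where
  "proj_perp phi y = y - inner y phi *\<^sub>R phi"

text \<open>M :: (nat \<Rightarrow> 'a) \<Rightarrow> 'b is a bounded j-linear map on S (depending only on its first j
arguments), with respect to the norms nA, nB.\<close>
definition ml_bounded ::
  "('a::real_vector \<Rightarrow> real) \<Rightarrow> ('b::real_vector \<Rightarrow> real) \<Rightarrow> 'a set \<Rightarrow> nat \<Rightarrow> ((nat \<Rightarrow> 'a) \<Rightarrow> 'b) \<Rightarrow> bool" where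
  "ml_bounded nA nB S j M \<longleftrightarrow>
     (\<forall>h h'. (\<forall>i<j. h i = h' i) \<longrightarrow> M h = M h') \<and>
     (\<forall>h. \<forall>i<j. \<forall>u\<in>S. \<forall>v\<in>S. \<forall>a b. (\<forall>l<j. h l \<in> S) \<longrightarrow>
         M (h(i := a *\<^sub>R u + b *\<^sub>R v)) = a *\<^sub>R M (h(i := u)) + b *\<^sub>R M (h(i := v))) \<and>
     (\<exists>B. \<forall>h. (\<forall>i<j. h i \<in> S) \<longrightarrow> nB (M h) \<le> B * (\<Prod>i<j. nA (h i)))"

definition ml_norm ::
  "('a::real_vector \<Rightarrow> real) \<Rightarrow> ('b::real_vector \<Rightarrow> real) \<Rightarrow> 'a set \<Rightarrow> nat \<Rightarrow> ((nat \<Rightarrow> 'a) \<Rightarrow> 'b) \<Rightarrow> real" where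
  "ml_norm nA nB S j M = Sup {nB (M h) | h. \<forall>i<j. h i \<in> S \<and> nA (h i) \<le> 1}"

text \<open>f is k times continuously Frechet differentiable on the linear subspace S (domain norm nA,
codomain norm nB). D j x is the j-th derivative at x, a bounded j-linear map.\<close>
definition Ck_on ::
  "('a::real_vector \<Rightarrow> real) \<Rightarrow> ('b::real_vector \<Rightarrow> real) \<Rightarrow> 'a set \<Rightarrow> nat \<Rightarrow> ('a \<Rightarrow> 'b) \<Rightarrow> bool" where
  "Ck_on nA nB S k f \<longleftrightarrow> (\<exists>D :: nat \<Rightarrow> 'a \<Rightarrow> (nat \<Rightarrow> 'a) \<Rightarrow> 'b.
     (\<forall>x\<in>S. \<forall>h. D 0 x h = f x) \<and>
     (\<forall>j\<le>k. \<forall>x\<in>S. ml_bounded nA nB S j (D j x)) \<and>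
     (\<forall>j<k. \<forall>x\<in>S. \<forall>\<epsilon>>0. \<exists>\<delta>>0. \<forall>y\<in>S. nA (y - x) < \<delta> \<longrightarrow>
        ml_norm nA nB S j (\<lambda>h. D j y h - D j x h - D (Suc j) x (h(j := y - x))) \<le> \<epsilon> * nA (y - x)) \<and>
     (\<forall>j\<le>k. \<forall>x\<in>S. \<forall>\<epsilon>>0. \<exists>\<delta>>0. \<forall>y\<in>S. nA (y - x) < \<delta> \<longrightarrow>
        ml_norm nA nB S j (\<lambda>h. D j y h - D j x h) \<le> \<epsilon>))"

definition Ck_diffeo ::
  "('a::real_vector \<Rightarrow> real) \<Rightarrow> ('b::real_vector \<Rightarrow> real) \<Rightarrow> 'a set \<Rightarrow> 'b set \<Rightarrow> nat \<Rightarrow> ('a \<Rightarrow> 'b) \<Rightarrow> bool" where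
  "Ck_diffeo nA nB S T k f \<longleftrightarrow> bij_betw f S T \<and> Ck_on nA nB S k f \<and>
     Ck_on nB nA T k (the_inv_into S f)"

end

theory Submission
  imports Defs
begin

text \<open>On \<open>H\<^sub>X\<close> the operator \<open>L\<close> is a bijection onto \<open>H\<^sub>Y\<close> with \<open>\<parallel>L w\<parallel> \<ge> m \<parallel>w\<parallel>\<close> for some
\<open>m > n\<close>, because \<open>[-n, n]\<close> meets the spectrum only in the eigenvalue that is split off. Instead of
the spectral theorem, the bound uses that the best constant \<open>c\<close> in \<open>\<parallel>A x\<parallel> \<ge> c \<parallel>x\<parallel>\<close> can be
improved as long as \<open>A - c\<close> and \<open>A + c\<close> are bounded below. With \<open>K\<close> the inverse of \<open>L\<close> composed with
\<open>P\<close>, the map \<open>PF\<^sub>t\<close> factors as \<open>\<psi> \<circ> L\<close> with \<open>\<psi> = id - PN\<^sub>t \<circ> K\<close>, and \<open>PN\<^sub>t \<circ> K\<close> is a contraction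
with constant \<open>n / m < 1\<close> on the whole of \<open>Y\<close>; this gives the bi-Lipschitz part. The inverse of \<open>\<psi>\<close>
has derivative \<open>\<psi>'(\<psi>\<^sup>-\<^sup>1 x)\<^sup>-\<^sup>1\<close>, and induction on the order with the chain rule for fields of multilinear maps
shows that it is as smooth as \<open>\<psi>\<close>.\<close>

section \<open>Spectral gaps\<close>

text \<open>The obstacle is that the eigenvalue lies in \<open>[-n, n]\<close> itself, where
  \<open>L\<close> has no resolvent; isolation is what makes \<open>L - lam_p\<close> bounded below
  on the complement of the eigenvector. Boundedness below is an open condition in the parameter, so
  it persists a little beyond both ends of \<open>[-n, n]\<close>, whence the strict inequality
  \<open>m > n\<close> on which the contraction rests. The factor \<open>P\<close> in
  \<open>K\<close> makes \<open>\<psi>\<close> a self-map of the whole Hilbert space, so derivatives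
  of all orders can be handled with one space and one norm; \<open>K\<close> carries the results
  back to the graph norm. The smoothness hypothesis concerns \<open>L - N\<close> on the domain, so
  the smoothness of \<open>\<psi>\<close> is read off from
  \<open>\<psi> u = PF (K u) + (u - P u)\<close> and not from \<open>N\<close>. The derivative of
  \<open>\<psi>\<close> at any point is within \<open>n / m\<close> of the identity, hence
  invertible with a bound independent of the point. The derivative of the inverse
  \<open>\<phi>\<close> again contains \<open>\<phi>\<close>, as \<open>R (\<phi> x)\<close>;
  differentiating fields along \<open>\<phi>\<close> with \<open>R\<close> kept separate avoids the
  circularity.\<close>

definition bounded_below_on :: "'a::real_normed_vector set \<Rightarrow> ('a \<Rightarrow> 'b::real_normed_vector) \<Rightarrow> bool" where
  "bounded_below_on S f \<longleftrightarrow> (\<exists>c>0. \<forall>x\<in>S. c * norm x \<le> norm (f x))"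

lemma bounded_below_onE:
  assumes "bounded_below_on S f"
  obtains c where "c > 0" "\<And>x. x \<in> S \<Longrightarrow> c * norm x \<le> norm (f x)"
  using assms unfolding bounded_below_on_def by blast

locale symmetric_on =
  fixes S :: "'a::real_inner set" and A :: "'a \<Rightarrow> 'a"
  assumes lin: "linear_on_dom S A"
    and sym: "\<And>x y. x \<in> S \<Longrightarrow> y \<in> S \<Longrightarrow> inner (A x) y = inner x (A y)"
begin

lemma sub: "subspace S"
  and add: "x \<in> S \<Longrightarrow> y \<in> S \<Longrightarrow> A (x + y) = A x + A y"
  and scale: "x \<in> S \<Longrightarrow> A (c *\<^sub>R x) = c *\<^sub>R A x"
  using lin unfolding linear_on_dom_def by auto

lemma diff: "x \<in> S \<Longrightarrow> y \<in> S \<Longrightarrow> A (x - y) = A x - A y"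
  using add[of x "-1 *\<^sub>R y"] scale[of y "-1"] subspace_scale[OF sub, of y "-1"] by simp

lemmas closed_ops = subspace_add[OF sub] subspace_diff[OF sub] subspace_scale[OF sub] subspace_0[OF sub]

lemma shift: "symmetric_on S (\<lambda>x. A x - mu *\<^sub>R x)"
proof
  show "linear_on_dom S (\<lambda>x. A x - mu *\<^sub>R x)"
    unfolding linear_on_dom_def by (auto simp: sub add scale algebra_simps)
qed (simp add: sym inner_diff_left inner_diff_right)

lemma restrict: "subspace T \<Longrightarrow> symmetric_on (S \<inter> T) A"
  by unfold_locales (auto simp: linear_on_dom_def sub add scale sym intro: subspace_inter)

text \<open>With \<open>x = A y\<close>, symmetry makes \<open>A\<^sup>2 y - c\<^sup>2 y = (A - c) (A + c) y\<close> small compared with \<open>A x\<close>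
as soon as \<open>\<parallel>A x\<parallel>\<close> is close to \<open>c \<parallel>x\<parallel>\<close>.\<close>
lemma lower_bound_improve:
  assumes sur: "S \<subseteq> A ` S" and c: "c > 0" "\<And>x. x \<in> S \<Longrightarrow> c * norm x \<le> norm (A x)"
    and p: "bounded_below_on S (\<lambda>x. A x - c *\<^sub>R x)"
    and m: "bounded_below_on S (\<lambda>x. A x - (- c) *\<^sub>R x)"
  shows "\<exists>c'>c. \<forall>x\<in>S. c' * norm x \<le> norm (A x)"
proof -
  obtain k1 where k1: "k1 > 0" "\<And>x. x \<in> S \<Longrightarrow> k1 * norm x \<le> norm (A x - c *\<^sub>R x)"
    using bounded_below_onE[OF p] by blast
  obtain k2 where k2: "k2 > 0" "\<And>x. x \<in> S \<Longrightarrow> k2 * norm x \<le> norm (A x - (- c) *\<^sub>R x)"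
    using bounded_below_onE[OF m] by blast
  define k where "k = k1 * k2"
  have k: "k > 0" using k1 k2 by (simp add: k_def)
  \<comment> \<open>Dividing \<open>kq\<close> below by \<open>k\<close> bounds \<open>y\<close> by
    \<open>?q\<close>, which gives \<open>norm ?z <= (1 + c^2 / k) * norm ?q\<close>;
    \<open>K\<close> is the square of this factor.\<close>
  define K where "K = (1 + c\<^sup>2 / k)\<^sup>2"
  have K: "K > 1" unfolding K_def using c k by (auto intro!: one_less_power)
  have main: "K * (c\<^sup>2 * (norm x)\<^sup>2) \<le> (K - 1) * (norm (A x))\<^sup>2" if x: "x \<in> S" for x
  proof -
    obtain y where y: "y \<in> S" "x = A y" using sur x by blast
    let ?z = "A x" let ?q = "A x - c\<^sup>2 *\<^sub>R y"
    have w: "A y - (-c) *\<^sub>R y \<in> S" using x y closed_ops by auto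
    have eq: "A (A y - (-c) *\<^sub>R y) - c *\<^sub>R (A y - (-c) *\<^sub>R y) = ?q"
      using x y diff[of "A y" "(-c) *\<^sub>R y"] scale[of y "-c"] closed_ops(3)[of y "-c"]
      by (simp add: algebra_simps power2_eq_square)
    have "k * norm y \<le> k1 * norm (A y - (-c) *\<^sub>R y)"
      unfolding k_def using k2(2)[OF y(1)] k1(1) by (simp add: mult.assoc)
    also have "\<dots> \<le> norm ?q" using k1(2)[OF w] unfolding eq .
    finally have kq: "k * norm y \<le> norm ?q" .
    have "norm ?z \<le> norm ?q + norm (c\<^sup>2 *\<^sub>R y)" using norm_triangle_ineq[of ?q "c\<^sup>2 *\<^sub>R y"] by simp
    also have "\<dots> = norm ?q + c\<^sup>2 / k * (k * norm y)" using k by simp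
    also have "\<dots> \<le> norm ?q + c\<^sup>2 / k * norm ?q" using kq k by (intro add_left_mono mult_left_mono) auto
    finally have "norm ?z \<le> (1 + c\<^sup>2 / k) * norm ?q" by (simp add: algebra_simps)
    then have zK: "(norm ?z)\<^sup>2 \<le> K * (norm ?q)\<^sup>2"
      unfolding K_def power_mult_distrib[symmetric] by (rule power_mono) simp
    \<comment> \<open>Symmetry evaluates the cross term of the expanded square exactly; half of it
      survives after the last term is absorbed by \<open>c * norm y <= norm x\<close>.\<close>
    have "inner ?z y = (norm x)\<^sup>2" using sym[OF x y(1)] y by (simp add: power2_norm_eq_inner)
    then have q: "(norm ?q)\<^sup>2 = (norm ?z)\<^sup>2 - 2 * c\<^sup>2 * (norm x)\<^sup>2 + c\<^sup>2 * (c * norm y)\<^sup>2"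
      unfolding power2_norm_eq_inner power_mult_distrib
      by (simp add: inner_diff_left inner_diff_right inner_commute power2_eq_square algebra_simps)
    have "(c * norm y)\<^sup>2 \<le> (norm x)\<^sup>2" using c(2)[OF y(1)] y(2) c(1) by (intro power_mono) auto
    then have "c\<^sup>2 * (c * norm y)\<^sup>2 \<le> c\<^sup>2 * (norm x)\<^sup>2" by (intro mult_left_mono) auto
    then have "(norm ?q)\<^sup>2 \<le> (norm ?z)\<^sup>2 - c\<^sup>2 * (norm x)\<^sup>2" unfolding q by simp
    then have "K * (norm ?q)\<^sup>2 \<le> K * ((norm ?z)\<^sup>2 - c\<^sup>2 * (norm x)\<^sup>2)" using K by (intro mult_left_mono) auto
    with zK show ?thesis by (simp add: algebra_simps)
  qed
  \<comment> \<open>\<open>main\<close> says that the square of \<open>norm (A x)\<close> is at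
    least \<open>K / (K - 1)\<close> times that of \<open>c * norm x\<close>, and this factor
    exceeds 1.\<close>
  define c' where "c' = sqrt (K / (K - 1)) * c"
  have c'2: "c'\<^sup>2 = K / (K - 1) * c\<^sup>2" using K by (simp add: c'_def power_mult_distrib)
  have "c' > c" using K c(1) by (simp add: c'_def real_less_rsqrt)
  moreover have "c' * norm x \<le> norm (A x)" if x: "x \<in> S" for x
  proof (rule power2_le_imp_le)
    show "(c' * norm x)\<^sup>2 \<le> (norm (A x))\<^sup>2"
      using main[OF x] K by (simp add: power_mult_distrib c'2 field_simps)
  qed simp
  ultimately show ?thesis by blast
qed

text \<open>Stands in for the estimate by the distance from 0 to the spectrum. The supremum of the
  admissible constants is admissible, each inequality being closed in the constant; a supremum below
  \<open>r\<close> would contradict \<open>lower_bound_improve\<close>.\<close>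

lemma spectral_gap_bound:
  assumes sur: "S \<subseteq> A ` S" and r: "r > 0"
    and bb: "\<And>l. \<bar>l\<bar> < r \<Longrightarrow> bounded_below_on S (\<lambda>x. A x - l *\<^sub>R x)"
    and x: "x \<in> S"
  shows "r * norm x \<le> norm (A x)"
proof -
  define C where "C = {c. \<forall>x\<in>S. c * norm x \<le> norm (A x)}"
  have down: "c' \<in> C" if "c \<in> C" "c' \<le> c" for c c'
    using that unfolding C_def by (auto intro: order_trans[OF mult_right_mono[of c' c]])
  have "r \<in> C"
  proof (rule ccontr)
    assume r': "r \<notin> C"
    have bdd: "bdd_above C" using down r' by (intro bdd_aboveI[of _ r]) (meson linear)
    obtain c0 where c0: "c0 > 0" "c0 \<in> C"
      using bb[of 0] r unfolding bounded_below_on_def C_def by auto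
    let ?s = "Sup C"
    have s0: "?s > 0" using cSup_upper[OF c0(2) bdd] c0(1) by simp
    have sC: "?s \<in> C"
    proof -
      have "?s * norm x \<le> norm (A x)" if "x \<in> S" for x
      proof (cases "x = 0")
        case False
        have "?s \<le> norm (A x) / norm x"
          using c0 False that by (intro cSup_least) (auto simp: C_def field_simps)
        then show ?thesis using False by (simp add: field_simps)
      qed simp
      then show ?thesis by (simp add: C_def)
    qed
    have sr: "?s < r" using down[OF sC, of r] r' by linarith
    obtain c' where "c' > ?s" "c' \<in> C"
      using lower_bound_improve[OF sur s0 _ bb bb] sC s0 sr by (auto simp: C_def)
    then show False using cSup_upper[OF _ bdd, of c'] by simp
  qed
  then show ?thesis using x by (simp add: C_def)
qed

end

section \<open>Self-adjoint operators on the complement of an eigenvector\<close>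

abbreviation (input) perp :: "'a::real_inner \<Rightarrow> 'a set" where
  "perp phi \<equiv> {y. inner y phi = 0}"

lemma subspace_perp: "subspace (perp phi)"
  by (auto simp: subspace_def inner_add_left)

lemma closed_perp: "closed (perp phi)"
  by (intro closed_Collect_eq continuous_intros)

lemma not_in_spectrum:
  assumes "mu \<notin> spectrum_op D L"
  shows "bounded_below_on D (\<lambda>x. L x - mu *\<^sub>R x)" "(\<lambda>x. L x - mu *\<^sub>R x) ` D = UNIV"
proof -
  obtain C where bij: "bij_betw (\<lambda>x. L x - mu *\<^sub>R x) D UNIV"
    and C: "\<And>x. x \<in> D \<Longrightarrow> norm x \<le> C * norm (L x - mu *\<^sub>R x)"
    using assms unfolding spectrum_op_def by blast
  show "(\<lambda>x. L x - mu *\<^sub>R x) ` D = UNIV" using bij by (rule bij_betw_imp_surj_on)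
  \<comment> \<open>\<open>spectrum_op\<close> fixes no sign for \<open>C\<close>;
    \<open>max C 1\<close> has a positive reciprocal.\<close>
  have "1 / max C 1 * norm x \<le> norm (L x - mu *\<^sub>R x)" if "x \<in> D" for x
  proof -
    have "norm x \<le> max C 1 * norm (L x - mu *\<^sub>R x)"
      using C[OF that] by (rule order_trans) (simp add: mult_right_mono)
    then show ?thesis by (simp add: field_simps)
  qed
  then show "bounded_below_on D (\<lambda>x. L x - mu *\<^sub>R x)"
    unfolding bounded_below_on_def by (intro exI[of _ "1 / max C 1"]) auto
qed

lemma bounded_below_on_subset: "bounded_below_on S f \<Longrightarrow> T \<subseteq> S \<Longrightarrow> bounded_below_on T f"
  unfolding bounded_below_on_def by blast

text \<open>Moving the parameter costs at most its displacement in the constant. Applied at the two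
  ends of an interval, this gives room beyond them.\<close>

lemma bounded_below_on_shift_near:
  assumes c: "\<And>x. x \<in> S \<Longrightarrow> c * norm x \<le> norm (A x - mu *\<^sub>R x)" and nu: "\<bar>nu - mu\<bar> < c"
  shows "bounded_below_on S (\<lambda>x. A x - nu *\<^sub>R x)"
  unfolding bounded_below_on_def
proof (intro exI[of _ "c - \<bar>nu - mu\<bar>"] conjI ballI)
  fix x assume x: "x \<in> S"
  have "norm (A x - mu *\<^sub>R x) \<le> norm (A x - nu *\<^sub>R x) + norm ((nu - mu) *\<^sub>R x)"
    using norm_triangle_ineq[of "A x - nu *\<^sub>R x" "(nu - mu) *\<^sub>R x"] by (simp add: scaleR_diff_left)
  then show "(c - \<bar>nu - mu\<bar>) * norm x \<le> norm (A x - nu *\<^sub>R x)"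
    using c[OF x] unfolding norm_scaleR by (simp add: algebra_simps)
qed (use nu in auto)

lemma self_adjoint_symmetric_on: "self_adjoint_op D L \<Longrightarrow> symmetric_on D L"
  by unfold_locales (auto simp: self_adjoint_op_def)

text \<open>Adjoints have closed graphs, and \<open>L\<close> is its own adjoint: the limit of the
  symmetry relation puts \<open>a\<close> into the domain of the adjoint, which is \<open>D\<close>,
  and density of \<open>D\<close> identifies \<open>L a\<close>.\<close>

lemma self_adjoint_closed:
  assumes SA: "self_adjoint_op D L" and xD: "\<And>k. x k \<in> D"
    and x: "x \<longlonglongrightarrow> a" and Lx: "(\<lambda>k. L (x k)) \<longlonglongrightarrow> b"
  shows "a \<in> D" "L a = b"
proof -
  note SA = SA[unfolded self_adjoint_op_def]
  have ab: "inner (L v) a = inner v b" if v: "v \<in> D" for v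
  proof (rule LIMSEQ_unique)
    show "(\<lambda>k. inner (L v) (x k)) \<longlonglongrightarrow> inner (L v) a" using x by (intro tendsto_intros)
    have "(\<lambda>k. inner v (L (x k))) \<longlonglongrightarrow> inner v b" using Lx by (intro tendsto_intros)
    then show "(\<lambda>k. inner (L v) (x k)) \<longlonglongrightarrow> inner v b" using SA xD v by simp
  qed
  then show aD: "a \<in> D" using SA by blast
  have "D \<subseteq> {v. inner v (L a - b) = 0}" using ab SA aD by (auto simp: inner_diff_right)
  moreover have "closed {v. inner v (L a - b) = 0}" by (intro closed_Collect_eq continuous_intros)
  ultimately have "closure D \<subseteq> {v. inner v (L a - b) = 0}" by (rule closure_minimal)
  then have "L a - b \<in> {v. inner v (L a - b) = 0}" using SA by blast
  then show "L a = b" by simp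
qed

text \<open>The hypotheses say \<open>B\<^sup>2 \<plusminus> e B \<ge> 0\<close>; they are applied to \<open>e v + B v\<close> and \<open>e v - B v\<close> and added.\<close>
lemma square_lower_bound:
  assumes B: "symmetric_on D B" and v: "v \<in> D" "B v \<in> D" and e: "e \<ge> 0"
    and p: "\<And>x. x \<in> D \<Longrightarrow> e * inner (B x) x \<le> (norm (B x))\<^sup>2"
    and m: "\<And>x. x \<in> D \<Longrightarrow> - e * inner (B x) x \<le> (norm (B x))\<^sup>2"
  shows "e * norm (B v) \<le> norm (B (B v))"
proof (rule power2_le_imp_le)
  interpret symmetric_on D B by fact
  let ?u = "B v"
  have ev: "e *\<^sub>R v \<in> D" using v closed_ops by blast
  have 1: "B (e *\<^sub>R v + ?u) = e *\<^sub>R ?u + B ?u" "B (e *\<^sub>R v - ?u) = e *\<^sub>R ?u - B ?u"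
    using add[OF ev v(2)] diff[OF ev v(2)] scale[OF v(1)] by auto
  have 2: "inner (B ?u) v = inner ?u ?u" "inner v (B ?u) = inner ?u ?u"
    using sym[OF v(2) v(1)] by (auto simp: inner_commute)
  define a b c d where "a = inner ?u ?u" and "b = inner (B ?u) ?u" and "c = inner (B ?u) (B ?u)"
    and "d = inner ?u v"
  note abcd = a_def b_def c_def d_def
  have 3: "inner (e *\<^sub>R ?u + B ?u) (e *\<^sub>R v + ?u) = e * e * d + 2 * (e * a) + b"
    "inner (e *\<^sub>R ?u - B ?u) (e *\<^sub>R v - ?u) = e * e * d - 2 * (e * a) + b"
    "(norm (e *\<^sub>R ?u + B ?u))\<^sup>2 = e * e * a + 2 * (e * b) + c"
    "(norm (e *\<^sub>R ?u - B ?u))\<^sup>2 = e * e * a - 2 * (e * b) + c"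
    unfolding power2_norm_eq_inner abcd
    by (simp_all add: inner_add_left inner_add_right inner_diff_left inner_diff_right 2
        inner_commute[of ?u "B ?u"] distrib_left right_diff_distrib mult.assoc)
  \<comment> \<open>Adding the two inequalities cancels the terms in \<open>d\<close> and
    \<open>b\<close> and leaves \<open>4 e^2 a <= 2 e^2 a + 2 c\<close>.\<close>
  have "e * (e * e * d + 2 * (e * a) + b) \<le> e * e * a + 2 * (e * b) + c"
    "- e * (e * e * d - 2 * (e * a) + b) \<le> e * e * a - 2 * (e * b) + c"
    using p[of "e *\<^sub>R v + ?u"] m[of "e *\<^sub>R v - ?u"] closed_ops(1,2)[OF ev v(2)] unfolding 1 3 by auto
  then have "e * e * a \<le> c" by (simp add: algebra_simps)
  then show "(e * norm ?u)\<^sup>2 \<le> (norm (B ?u))\<^sup>2"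
    unfolding power2_norm_eq_inner power_mult_distrib abcd by (simp add: power2_eq_square)
qed simp

lemma isolated_eigenvalue_bounded_below:
  fixes D :: "'a::{real_inner, complete_space} set"
  assumes SA: "self_adjoint_op D L" and EV: "simple_isolated_eigenvalue D L lam phi"
  shows "bounded_below_on (D \<inter> perp phi) (\<lambda>x. L x - lam *\<^sub>R x)"
proof -
  define B where "B = (\<lambda>x. L x - lam *\<^sub>R x)"
  note EV = EV[unfolded simple_isolated_eigenvalue_def]
  obtain e where e: "e > 0" "spectrum_op D L \<inter> {lam - e<..<lam + e} = {lam}" using EV by blast
  have res: "mu \<notin> spectrum_op D L" if "mu \<noteq> lam" "\<bar>mu - lam\<bar> < e" for mu
  proof
    assume "mu \<in> spectrum_op D L"
    then have "mu \<in> spectrum_op D L \<inter> {lam - e<..<lam + e}" using that by (auto simp: abs_if split: if_splits)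
    then show False using e that by auto
  qed
  interpret L: symmetric_on D L using SA by (rule self_adjoint_symmetric_on)
  interpret B: symmetric_on D B unfolding B_def by (rule L.shift)
  \<comment> \<open>The open interval of radius \<open>e / 2\<close> about \<open>lam + r\<close>
    just misses \<open>lam\<close> and stays within the isolation interval.\<close>
  have gap: "r\<^sup>2 * (norm x)\<^sup>2 \<le> (norm (B x - r *\<^sub>R x))\<^sup>2" if x: "x \<in> D" and r: "\<bar>r\<bar> = e / 2" for r x
  proof -
    have eq: "L x - (lam + r) *\<^sub>R x - l *\<^sub>R x = L x - (lam + r + l) *\<^sub>R x" for l x
      by (simp add: algebra_simps)
    have "\<bar>r\<bar> * norm x \<le> norm (L x - (lam + r) *\<^sub>R x)"
    proof (rule symmetric_on.spectral_gap_bound[OF L.shift _ _ _ x])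
      have "lam + r \<notin> spectrum_op D L" using res[of "lam + r"] e r by auto
      then show "D \<subseteq> (\<lambda>x. L x - (lam + r) *\<^sub>R x) ` D" using not_in_spectrum(2) by blast
      fix l assume "\<bar>l\<bar> < \<bar>r\<bar>"
      then have "lam + r + l \<notin> spectrum_op D L" using res[of "lam + r + l"] e r by auto
      then show "bounded_below_on D (\<lambda>x. L x - (lam + r) *\<^sub>R x - l *\<^sub>R x)"
        unfolding eq by (rule not_in_spectrum(1))
    qed (use e r in auto)
    then have "(\<bar>r\<bar> * norm x)\<^sup>2 \<le> (norm (L x - (lam + r) *\<^sub>R x))\<^sup>2" by (intro power_mono) auto
    then show ?thesis by (simp add: power_mult_distrib B_def algebra_simps)
  qed
  \<comment> \<open>Expanding the square cancels the terms in \<open>norm x\<close>; what remains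
    says that the quadratic form of \<open>B^2 - s e B\<close> is nonnegative.\<close>
  have ineq: "s * e * inner (B x) x \<le> (norm (B x))\<^sup>2" if "x \<in> D" "\<bar>s\<bar> = 1" for x s
  proof -
    have "\<bar>s * e / 2\<bar> = e / 2" using that e by (simp add: abs_mult)
    from gap[OF that(1) this]
    have "(s * e / 2)\<^sup>2 * (norm x)\<^sup>2 \<le> (norm (B x - (s * e / 2) *\<^sub>R x))\<^sup>2" .
    also have "\<dots> = (norm (B x))\<^sup>2 - 2 * (s * e / 2) * inner (B x) x + (s * e / 2)\<^sup>2 * (norm x)\<^sup>2"
      unfolding power2_norm_eq_inner
      by (simp only: inner_diff_left inner_diff_right inner_scaleR_left inner_scaleR_right
          inner_commute[of x "B x"] power2_eq_square) (simp add: mult.assoc right_diff_distrib diff_divide_distrib)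
    finally show ?thesis by simp
  qed
  have BB: "e * norm (B v) \<le> norm (B (B v))" if "v \<in> D" "B v \<in> D" for v
    using ineq[of _ 1] ineq[of _ "-1"] e that by (intro square_lower_bound[OF B.symmetric_on_axioms]) auto
  have "e * norm w \<le> norm (B w)" if w: "w \<in> D \<inter> perp phi" for w
  proof -
    \<comment> \<open>\<open>B (v k) = w + s k (B - s k)\<^sup>-\<^sup>1 w\<close> lies in the range of \<open>B\<close> and tends to \<open>w\<close>: its second
      summand \<open>z k\<close> is Cauchy, and its limit is in the kernel of \<open>B\<close> and orthogonal to it.\<close>
    define s where "s k = e / (real k + 2)" for k
    \<comment> \<open>The offset 2 keeps every \<open>s k\<close> inside the isolation interval and
      small enough for the absorption below.\<close>
    have s: "s k > 0" "s k \<le> e / 2" for k using e by (auto simp: s_def field_simps)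
    have s0: "s \<longlonglongrightarrow> 0" unfolding s_def by real_asymp
    have "\<exists>v\<in>D. B v - s k *\<^sub>R v = w" for k
    proof -
      have "lam + s k \<notin> spectrum_op D L" using res[of "lam + s k"] s[of k] e by auto
      then have "w \<in> (\<lambda>x. L x - (lam + s k) *\<^sub>R x) ` D" using not_in_spectrum(2) by blast
      then show ?thesis by (auto simp: B_def algebra_simps)
    qed
    then obtain v where v: "v k \<in> D" "B (v k) - s k *\<^sub>R v k = w" for k by metis
    define z where "z k = s k *\<^sub>R v k" for k
    have Bv: "B (v k) = w + z k" for k using v(2)[of k] by (simp add: z_def algebra_simps)
    have zD: "z k \<in> D" for k using v by (simp add: z_def B.closed_ops)
    have BvD: "B (v k) \<in> D" for k using w zD[of k] by (auto simp: Bv B.closed_ops)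
    have Bz: "B (z k) = s k *\<^sub>R B (v k)" for k using v by (simp add: z_def B.scale)
    have BBv: "B (B (v k)) = B w + s k *\<^sub>R B (v k)" for k
      using w zD[of k] B.add[of w "z k"] unfolding Bv[of k] by (simp add: Bz Bv)
    \<comment> \<open>Since \<open>s k <= e / 2\<close>, half of the left side absorbs the term with
      \<open>B (v k)\<close>; hence the factor 2.\<close>
    define M where "M = 2 * norm (B w) / e"
    have M: "norm (B (v k)) \<le> M" for k
    proof -
      have "e * norm (B (v k)) \<le> norm (B w + s k *\<^sub>R B (v k))"
        using BB[OF v(1) BvD] unfolding BBv .
      also have "\<dots> \<le> norm (B w) + s k * norm (B (v k))"
        using norm_triangle_ineq[of "B w" "s k *\<^sub>R B (v k)"] s(1)[of k] by simp
      also have "\<dots> \<le> norm (B w) + e / 2 * norm (B (v k))" using mult_right_mono[OF s(2)[of k], of "norm (B (v k))"] by simp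
      finally show ?thesis using e by (simp add: M_def field_simps)
    qed
    have perp: "inner (z k) phi = 0" for k
    proof -
      have "inner (B (v k)) phi = 0" using EV v B.sym[of "v k" phi] by (simp add: B_def)
      then show ?thesis using w Bv[of k] by (simp add: inner_add_left)
    qed
    have sB: "(\<lambda>k. s k *\<^sub>R B (v k)) \<longlonglongrightarrow> 0"
    proof (rule Lim_null_comparison)
      show "\<forall>\<^sub>F k in sequentially. norm (s k *\<^sub>R B (v k)) \<le> s k * M"
        using s M by (auto intro!: always_eventually mult_left_mono simp: less_imp_le)
      show "(\<lambda>k. s k * M) \<longlonglongrightarrow> 0" using tendsto_mult_left_zero[OF s0] .
    qed
    \<comment> \<open>The difference of two \<open>z\<close> is \<open>B\<close> of a difference of
      \<open>v\<close>, so \<open>BB\<close> bounds it by its image under \<open>B\<close>; the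
      images \<open>B (z k)\<close> tend to 0.\<close>
    have zz: "e * norm (z k - z l) \<le> norm (s k *\<^sub>R B (v k) - s l *\<^sub>R B (v l))" for k l
    proof -
      have *: "B (v k - v l) = z k - z l" using v by (simp add: B.diff Bv)
      have "e * norm (B (v k - v l)) \<le> norm (B (B (v k - v l)))"
        using v zD by (intro BB) (auto simp: * B.closed_ops)
      then show ?thesis unfolding * using zD by (simp add: B.diff Bz)
    qed
    have "Cauchy z"
    proof (rule metric_CauchyI)
      fix d :: real assume d: "d > 0"
      obtain K where K: "\<And>k l. k \<ge> K \<Longrightarrow> l \<ge> K \<Longrightarrow> dist (s k *\<^sub>R B (v k)) (s l *\<^sub>R B (v l)) < e * d"
        using metric_CauchyD[OF LIMSEQ_imp_Cauchy[OF sB] mult_pos_pos[OF e(1) d]] by blast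
      have "dist (z k) (z l) < d" if "k \<ge> K" "l \<ge> K" for k l
      proof -
        have "e * norm (z k - z l) < e * d"
          using zz[of k l] K[OF that] unfolding dist_norm by (rule le_less_trans)
        then show ?thesis using e(1) by (simp add: dist_norm)
      qed
      then show "\<exists>K. \<forall>k\<ge>K. \<forall>l\<ge>K. dist (z k) (z l) < d" by blast
    qed
    then obtain a where a: "z \<longlonglongrightarrow> a" by (auto simp: Cauchy_convergent_iff convergent_def)
    have "(\<lambda>k. s k *\<^sub>R B (v k) + lam *\<^sub>R z k) \<longlonglongrightarrow> 0 + lam *\<^sub>R a"
      using sB a by (intro tendsto_intros)
    moreover have "L (z k) = s k *\<^sub>R B (v k) + lam *\<^sub>R z k" for k
      unfolding Bz[symmetric] by (simp add: B_def)
    ultimately have "(\<lambda>k. L (z k)) \<longlonglongrightarrow> lam *\<^sub>R a" by simp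
    from self_adjoint_closed[OF SA zD a this] have "a \<in> {x \<in> D. L x = lam *\<^sub>R x}" by simp
    then have "a \<in> span {phi}" using EV by simp
    then obtain c where c: "a = c *\<^sub>R phi" by (auto simp: span_singleton)
    have "(\<lambda>k. inner (z k) phi) \<longlonglongrightarrow> inner a phi" using a by (intro tendsto_intros)
    then have "inner a phi = 0" using perp by (simp add: LIMSEQ_const_iff)
    moreover have "inner phi phi = 1" using EV by (simp flip: power2_norm_eq_inner)
    ultimately have "a = 0" using c by simp
    then have "(\<lambda>k. w + z k) \<longlonglongrightarrow> w + 0" using a by (intro tendsto_intros) auto
    then have "(\<lambda>k. e * norm (B (v k))) \<longlonglongrightarrow> e * norm w" unfolding Bv by (intro tendsto_intros) simp
    moreover have "(\<lambda>k. norm (B w + s k *\<^sub>R B (v k))) \<longlonglongrightarrow> norm (B w + 0)"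
      using sB by (intro tendsto_intros)
    moreover have "e * norm (B (v k)) \<le> norm (B w + s k *\<^sub>R B (v k))" for k
      using BB[OF v(1) BvD] unfolding BBv .
    ultimately have "e * norm w \<le> norm (B w + 0)" using LIMSEQ_le by blast
    then show ?thesis by simp
  qed
  then show ?thesis using e(1) unfolding bounded_below_on_def B_def by (intro exI[of _ e]) simp
qed

text \<open>Pairing \<open>L x - mu x\<close> with \<open>phi\<close> multiplies the pairing of
  \<open>x\<close> by \<open>lam - mu\<close>, which is nonzero, so preimages of orthogonal vectors
  are orthogonal.\<close>

lemma bij_perp_of_not_in_spectrum:
  assumes SA: "self_adjoint_op D L" and phi: "phi \<in> D" "L phi = lam *\<^sub>R phi"
    and mu: "mu \<notin> spectrum_op D L" "mu \<noteq> lam"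
  shows "(\<lambda>x. L x - mu *\<^sub>R x) ` (D \<inter> perp phi) = perp phi"
proof -
  interpret L: symmetric_on D L using SA by (rule self_adjoint_symmetric_on)
  have "inner (L x - mu *\<^sub>R x) phi = (lam - mu) * inner x phi" if "x \<in> D" for x
    using L.sym[OF that phi(1)] phi(2) by (simp add: inner_diff_left algebra_simps)
  then have iff: "L x - mu *\<^sub>R x \<in> perp phi \<longleftrightarrow> x \<in> perp phi" if "x \<in> D" for x
    using that mu(2) by simp
  show ?thesis
  proof (intro equalityI subsetI)
    fix y assume y: "y \<in> perp phi"
    have "y \<in> (\<lambda>x. L x - mu *\<^sub>R x) ` D" unfolding not_in_spectrum(2)[OF mu(1)] by (rule UNIV_I)
    then obtain x where x: "x \<in> D" "y = L x - mu *\<^sub>R x" by (rule imageE)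
    then have "x \<in> D \<inter> perp phi" using iff[OF x(1)] y by simp
    then show "y \<in> (\<lambda>x. L x - mu *\<^sub>R x) ` (D \<inter> perp phi)" using x(2) by (rule rev_image_eqI)
  next
    fix y assume "y \<in> (\<lambda>x. L x - mu *\<^sub>R x) ` (D \<inter> perp phi)"
    then obtain x where x: "x \<in> D \<inter> perp phi" "y = L x - mu *\<^sub>R x" by (rule imageE)
    then show "y \<in> perp phi" using iff[of x] by simp
  qed
qed

text \<open>Surjectivity of \<open>L\<close> on the complement needs an argument because
  \<open>lam\<close> may be 0. With \<open>R\<close> inverse to \<open>L - s\<close> for a resolvent
  point \<open>s\<close> near 0, the equation \<open>L x = y\<close> becomes the fixed point
  equation \<open>x = R (y - s x)\<close>.\<close>

lemma self_adjoint_perp_gap: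
  fixes D :: "'a::{real_inner, complete_space} set"
  assumes SA: "self_adjoint_op D L" and EV: "simple_isolated_eigenvalue D L lam phi"
    and n: "n \<ge> 0" and gap: "{-n..n} \<inter> spectrum_op D L = {lam}"
  shows "L ` (D \<inter> perp phi) = perp phi \<and> (\<exists>m>n. \<forall>w\<in>D \<inter> perp phi. m * norm w \<le> norm (L w))"
proof -
  let ?H = "D \<inter> perp phi"
  interpret L: symmetric_on D L using SA by (rule self_adjoint_symmetric_on)
  interpret H: symmetric_on ?H L by (intro L.restrict subspace_perp)
  have bb: "bounded_below_on ?H (\<lambda>x. L x - l *\<^sub>R x)" if "\<bar>l\<bar> \<le> n" for l
  proof (cases "l = lam")
    case True
    show ?thesis unfolding True by (rule isolated_eigenvalue_bounded_below[OF SA EV])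
  next
    case False
    have "l \<in> {-n..n}" using that by (simp add: abs_le_iff)
    then have "l \<notin> spectrum_op D L" using gap False by blast
    from not_in_spectrum(1)[OF this] show ?thesis by (rule bounded_below_on_subset) (rule Int_lower1)
  qed
  note EV = EV[unfolded simple_isolated_eigenvalue_def]
  obtain c where c: "c > 0" "\<And>x. x \<in> ?H \<Longrightarrow> c * norm x \<le> norm (L x)"
    using bb[of 0] n unfolding bounded_below_on_def by auto
  \<comment> \<open>If \<open>lam\<close> is 0, isolation leaves small positive resolvent points;
    otherwise 0 itself is one. The bound \<open>c / 2\<close> makes the fixed point map a
    contraction.\<close>
  obtain s where s: "s \<notin> spectrum_op D L" "s \<noteq> lam" "\<bar>s\<bar> < c / 2"
  proof (cases "lam = 0")
    case True
    obtain e where e: "e > 0" "spectrum_op D L \<inter> {lam - e<..<lam + e} = {lam}" using EV by blast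
    let ?s = "min e c / 3"
    have "?s \<in> {lam - e<..<lam + e}" "?s \<noteq> lam" "\<bar>?s\<bar> < c / 2" using e c True by auto
    then show ?thesis using that[of ?s] e by blast
  next
    case False
    moreover have "0 \<in> {-n..n}" using n by simp
    ultimately have "0 \<notin> spectrum_op D L" using gap by (metis IntI singletonD)
    then show ?thesis using that[of 0] False c(1) by simp
  qed
  define R where "R = inv_into ?H (\<lambda>x. L x - s *\<^sub>R x)"
  have img: "(\<lambda>x. L x - s *\<^sub>R x) ` ?H = perp phi"
    using EV s by (intro bij_perp_of_not_in_spectrum[OF SA]) auto
  have R: "R y \<in> ?H" "L (R y) - s *\<^sub>R R y = y" if "y \<in> perp phi" for y
  proof -
    have y: "y \<in> (\<lambda>x. L x - s *\<^sub>R x) ` ?H" unfolding img by (rule that)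
    show "R y \<in> ?H" unfolding R_def by (rule inv_into_into[OF y])
    show "L (R y) - s *\<^sub>R R y = y" unfolding R_def by (rule f_inv_into_f[OF y])
  qed
  \<comment> \<open>The term \<open>s ?d\<close> uses up at most half of the lower bound
    \<open>c\<close>; hence \<open>2 / c\<close>.\<close>
  have Rlip: "norm (R x - R y) \<le> 2 / c * norm (x - y)" if "x \<in> perp phi" "y \<in> perp phi" for x y
  proof -
    let ?d = "R x - R y"
    have d: "?d \<in> ?H" using R(1)[OF that(1)] R(1)[OF that(2)] by (rule H.closed_ops)
    have "L ?d = (x - y) + s *\<^sub>R ?d"
      using R[OF that(1)] R[OF that(2)] H.diff[of "R x" "R y"] by (simp add: algebra_simps)
    then have "c * norm ?d \<le> norm (x - y) + \<bar>s\<bar> * norm ?d"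
      using c(2)[OF d] norm_triangle_ineq[of "x - y" "s *\<^sub>R ?d"] by simp
    also have "\<dots> \<le> norm (x - y) + c / 2 * norm ?d"
      using s(3) by (intro add_left_mono mult_right_mono) auto
    finally show ?thesis using c(1) by (simp add: field_simps)
  qed
  have "y \<in> L ` ?H" if y: "y \<in> perp phi" for y
  proof -
    have Hx: "y - s *\<^sub>R x \<in> perp phi" if "x \<in> perp phi" for x using y that by (simp add: inner_diff_left)
    have "\<exists>!x. x \<in> perp phi \<and> R (y - s *\<^sub>R x) = x"
    proof (rule Banach_fix)
      show "complete (perp phi)" using closed_perp complete_eq_closed by blast
      show "perp phi \<noteq> {}" using y by blast
      show "0 \<le> 2 / c * \<bar>s\<bar>" "2 / c * \<bar>s\<bar> < 1" using c(1) s(3) by (auto simp: field_simps)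
      show "(\<lambda>x. R (y - s *\<^sub>R x)) ` perp phi \<subseteq> perp phi"
        using R(1)[OF Hx] by (intro image_subsetI) blast
      fix u v assume uv: "u \<in> perp phi" "v \<in> perp phi"
      have "norm (R (y - s *\<^sub>R u) - R (y - s *\<^sub>R v)) \<le> 2 / c * norm ((y - s *\<^sub>R u) - (y - s *\<^sub>R v))"
        by (intro Rlip Hx uv)
      also have "(y - s *\<^sub>R u) - (y - s *\<^sub>R v) = s *\<^sub>R (v - u)" by (simp add: algebra_simps)
      finally show "dist (R (y - s *\<^sub>R u)) (R (y - s *\<^sub>R v)) \<le> 2 / c * \<bar>s\<bar> * dist u v"
        by (simp add: dist_norm norm_minus_commute)
    qed
    then obtain x where "x \<in> perp phi" "R (y - s *\<^sub>R x) = x" by blast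
    with R[OF Hx, of x] have "x \<in> ?H" "y = L x" by auto
    then show ?thesis by (rule rev_image_eqI)
  qed
  moreover have "inner (L x) phi = 0" if "x \<in> ?H" for x
    using L.sym[of x phi] EV that by simp
  ultimately have img: "L ` ?H = perp phi" by auto
  \<comment> \<open>The margins at the two end points are what lifts the bound strictly above
    \<open>n\<close>.\<close>
  obtain c1 where c1: "c1 > 0" "\<And>x. x \<in> ?H \<Longrightarrow> c1 * norm x \<le> norm (L x - n *\<^sub>R x)"
    using bounded_below_onE[OF bb[of n]] n by auto
  obtain c2 where c2: "c2 > 0" "\<And>x. x \<in> ?H \<Longrightarrow> c2 * norm x \<le> norm (L x - (-n) *\<^sub>R x)"
    using bounded_below_onE[OF bb[of "-n"]] n by auto
  let ?m = "n + min c1 c2"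
  have "?m * norm w \<le> norm (L w)" if "w \<in> ?H" for w
  proof (rule H.spectral_gap_bound[OF _ _ _ that])
    show "?H \<subseteq> L ` ?H" unfolding img by simp
    show "?m > 0" using n c1 c2 by simp
    fix l assume l: "\<bar>l\<bar> < ?m"
    consider "\<bar>l\<bar> \<le> n" | "l > n" | "l < - n" by linarith
    then show "bounded_below_on ?H (\<lambda>x. L x - l *\<^sub>R x)"
    proof cases
      case 2
      then show ?thesis using l by (intro bounded_below_on_shift_near[OF c1(2)]) auto
    next
      case 3
      then show ?thesis using l by (intro bounded_below_on_shift_near[OF c2(2)]) auto
    qed (rule bb)
  qed
  moreover have "?m > n" using c1 c2 by simp
  ultimately show ?thesis using img by blast
qed

section \<open>Smooth families of multilinear maps\<close>

text \<open>A multilinear map takes a family \<open>h\<close> of vectors and depends only on the entries with index in the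
finite set \<open>V\<close> of its variables. Index sets instead of arities let one variable be replaced by a
multilinear expression in others without reindexing.\<close>

definition tprod :: "nat set \<Rightarrow> (nat \<Rightarrow> 'a::real_normed_vector) \<Rightarrow> real" where
  "tprod V h = (\<Prod>i\<in>V. norm (h i))"

definition tensor :: "nat set \<Rightarrow> ((nat \<Rightarrow> 'a::real_normed_vector) \<Rightarrow> 'a) \<Rightarrow> bool" where
  "tensor V M \<longleftrightarrow> (\<forall>h h'. (\<forall>i\<in>V. h i = h' i) \<longrightarrow> M h = M h') \<and>
     (\<forall>h. \<forall>i\<in>V. linear (\<lambda>u. M (h(i := u)))) \<and>
     (\<exists>B. \<forall>h. norm (M h) \<le> B * tprod V h)"

text \<open>Here and in \<open>tensor_deriv\<close> the operator norm is written out as a bound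
  uniform in \<open>h\<close>, so that no supremum has to be shown to exist.\<close>

definition tensor_cont :: "nat set \<Rightarrow> ('a::real_normed_vector \<Rightarrow> (nat \<Rightarrow> 'a) \<Rightarrow> 'a) \<Rightarrow> bool" where
  "tensor_cont V E \<longleftrightarrow> (\<forall>x. \<forall>\<epsilon>>0. \<forall>\<^sub>F y in nhds x. \<forall>h. norm (E y h - E x h) \<le> \<epsilon> * tprod V h)"

definition tensor_deriv ::
  "nat set \<Rightarrow> nat \<Rightarrow> ('a::real_normed_vector \<Rightarrow> (nat \<Rightarrow> 'a) \<Rightarrow> 'a) \<Rightarrow> ('a \<Rightarrow> (nat \<Rightarrow> 'a) \<Rightarrow> 'a) \<Rightarrow> bool" where
  "tensor_deriv V v E E' \<longleftrightarrow> (\<forall>x. \<forall>\<epsilon>>0. \<forall>\<^sub>F y in nhds x. \<forall>h.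
     norm (E y h - E x h - E' x (h(v := y - x))) \<le> \<epsilon> * norm (y - x) * tprod V h)"

text \<open>The direction of differentiation is an additional variable \<open>v\<close>. Asking for a derivative for every
fresh \<open>v\<close> allows derivatives of different fields to share it.\<close>

primrec smooth_tensor :: "nat \<Rightarrow> nat set \<Rightarrow> ('a::real_normed_vector \<Rightarrow> (nat \<Rightarrow> 'a) \<Rightarrow> 'a) \<Rightarrow> bool" where
  "smooth_tensor 0 V E \<longleftrightarrow> finite V \<and> (\<forall>x. tensor V (E x)) \<and> tensor_cont V E"
| "smooth_tensor (Suc r) V E \<longleftrightarrow> (finite V \<and> (\<forall>x. tensor V (E x)) \<and> tensor_cont V E) \<and>
     (\<forall>v. v \<notin> V \<longrightarrow> (\<exists>E'. smooth_tensor r (insert v V) E' \<and> tensor_deriv V v E E'))"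

lemma smooth_tensorD:
  assumes "smooth_tensor r V E"
  shows "finite V" "tensor V (E x)" "tensor_cont V E"
  using assms by (cases r; simp)+

lemma smooth_tensor_Suc_D: "smooth_tensor (Suc r) V E \<Longrightarrow> smooth_tensor r V E"
proof (induction r arbitrary: V E)
  case (Suc r)
  show ?case
    unfolding smooth_tensor.simps(2)[of r]
  proof (intro conjI allI impI)
    fix v assume "v \<notin> V"
    then obtain E' where "smooth_tensor (Suc r) (insert v V) E'" "tensor_deriv V v E E'"
      using Suc.prems by (auto simp only: smooth_tensor.simps(2)[of "Suc r"])
    then show "\<exists>E'. smooth_tensor r (insert v V) E' \<and> tensor_deriv V v E E'"
      using Suc.IH[of "insert v V" E'] by auto
  qed (use smooth_tensorD[OF Suc.prems] in auto)
qed simp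

lemma smooth_tensor_derivE:
  assumes "smooth_tensor (Suc r) V E" "v \<notin> V"
  obtains E' where "smooth_tensor r (insert v V) E'" "tensor_deriv V v E E'"
  using assms by auto

section \<open>Estimates for single multilinear maps\<close>

lemma tprod_nonneg [simp]: "0 \<le> tprod V h"
  by (simp add: tprod_def prod_nonneg)

lemma tprod_upd_notin [simp]: "v \<notin> V \<Longrightarrow> tprod V (h(v := u)) = tprod V h"
  unfolding tprod_def by (rule prod.cong) auto

lemma tprod_insert: "finite V \<Longrightarrow> v \<notin> V \<Longrightarrow> tprod (insert v V) h = norm (h v) * tprod V h"
  by (simp add: tprod_def)

lemma tprod_upd: "finite V \<Longrightarrow> a \<in> V \<Longrightarrow> tprod V (h(a := u)) = norm u * tprod (V - {a}) h"
  using tprod_insert[of "V - {a}" a "h(a := u)"] by (simp add: insert_absorb)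

lemma tprod_Un: "finite V \<Longrightarrow> finite W \<Longrightarrow> W \<inter> V = {} \<Longrightarrow> tprod (V \<union> W) h = tprod W h * tprod V h"
  unfolding tprod_def by (subst prod.union_disjoint) (auto simp: mult.commute)

lemma tprod_singleton [simp]: "tprod {c} h = norm (h c)"
  by (simp add: tprod_def)

lemma tensor_dep: "tensor V M \<Longrightarrow> (\<And>i. i \<in> V \<Longrightarrow> h i = h' i) \<Longrightarrow> M h = M h'"
  unfolding tensor_def by metis

lemma tensor_linear: "tensor V M \<Longrightarrow> i \<in> V \<Longrightarrow> linear (\<lambda>u. M (h(i := u)))"
  unfolding tensor_def by metis

lemma tensor_diff: "tensor V M \<Longrightarrow> a \<in> V \<Longrightarrow> M (h(a := p - q)) = M (h(a := p)) - M (h(a := q))"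
  using linear_diff[OF tensor_linear[of V M a h]] by simp

lemma tensor_boundE:
  assumes "tensor V M"
  obtains B where "B \<ge> 0" "\<And>h. norm (M h) \<le> B * tprod V h"
proof -
  obtain B where B: "\<And>h. norm (M h) \<le> B * tprod V h" using assms unfolding tensor_def by metis
  have "norm (M h) \<le> max B 0 * tprod V h" for h
    using B[of h] by (rule order_trans) (simp add: mult_right_mono)
  then show ?thesis using that[of "max B 0"] by simp
qed

lemma tensorI:
  assumes "\<And>h h'. (\<And>i. i \<in> V \<Longrightarrow> h i = h' i) \<Longrightarrow> M h = M h'"
    and "\<And>h i. i \<in> V \<Longrightarrow> linear (\<lambda>u. M (h(i := u)))"
    and "\<And>h. norm (M h) \<le> B * tprod V h"
  shows "tensor V M"
  unfolding tensor_def
proof (intro conjI allI ballI impI exI[of _ B])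
  show "M h = M h'" if "\<forall>i\<in>V. h i = h' i" for h h'
    by (rule assms(1)) (use that in blast)
qed (fact assms(2,3))+

text \<open>The estimates below end in a constant times \<open>\<epsilon>\<close>. As
  \<open>K\<close> is chosen before \<open>\<epsilon>\<close>, shrinking \<open>\<epsilon>\<close>
  absorbs it.\<close>

lemma tensor_contI:
  assumes "\<And>x. \<exists>K. \<forall>\<epsilon>. 0 < \<epsilon> \<longrightarrow> \<epsilon> \<le> 1 \<longrightarrow> (\<forall>\<^sub>F y in nhds x. \<forall>h. norm (E y h - E x h) \<le> K * \<epsilon> * tprod V h)"
  shows "tensor_cont V E"
  unfolding tensor_cont_def
proof (intro allI impI)
  fix x :: 'a and \<epsilon> :: real assume e: "\<epsilon> > 0"
  obtain K where K: "\<And>\<epsilon>. 0 < \<epsilon> \<Longrightarrow> \<epsilon> \<le> 1 \<Longrightarrow> (\<forall>\<^sub>F y in nhds x. \<forall>h. norm (E y h - E x h) \<le> K * \<epsilon> * tprod V h)"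
    using assms[of x] by blast
  define e' where "e' = min 1 (\<epsilon> / (\<bar>K\<bar> + 1))"
  have e': "0 < e'" "e' \<le> 1" using e by (auto simp: e'_def)
  have "K * e' \<le> (\<bar>K\<bar> + 1) * (\<epsilon> / (\<bar>K\<bar> + 1))"
    using e' by (intro mult_mono) (auto simp: e'_def)
  then have Ke: "K * e' \<le> \<epsilon>" by (simp add: add_pos_nonneg)
  show "\<forall>\<^sub>F y in nhds x. \<forall>h. norm (E y h - E x h) \<le> \<epsilon> * tprod V h"
    using K[OF e'] by (rule eventually_mono) (meson Ke mult_right_mono order_trans tprod_nonneg)
qed

lemma tensor_derivI:
  assumes "\<And>x. \<exists>K. \<forall>\<epsilon>. 0 < \<epsilon> \<longrightarrow> \<epsilon> \<le> 1 \<longrightarrow> (\<forall>\<^sub>F y in nhds x. \<forall>h.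
      norm (E y h - E x h - E' x (h(v := y - x))) \<le> K * \<epsilon> * (norm (y - x) * tprod V h))"
  shows "tensor_deriv V v E E'"
  unfolding tensor_deriv_def
proof (intro allI impI)
  fix x :: 'a and \<epsilon> :: real assume e: "\<epsilon> > 0"
  obtain K where K: "\<And>\<epsilon>. 0 < \<epsilon> \<Longrightarrow> \<epsilon> \<le> 1 \<Longrightarrow> (\<forall>\<^sub>F y in nhds x. \<forall>h.
      norm (E y h - E x h - E' x (h(v := y - x))) \<le> K * \<epsilon> * (norm (y - x) * tprod V h))"
    using assms[of x] by blast
  define e' where "e' = min 1 (\<epsilon> / (\<bar>K\<bar> + 1))"
  have e': "0 < e'" "e' \<le> 1" using e by (auto simp: e'_def)
  have "K * e' \<le> (\<bar>K\<bar> + 1) * (\<epsilon> / (\<bar>K\<bar> + 1))"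
    using e' by (intro mult_mono) (auto simp: e'_def)
  then have Ke: "K * e' \<le> \<epsilon>" by (simp add: add_pos_nonneg)
  show "\<forall>\<^sub>F y in nhds x. \<forall>h. norm (E y h - E x h - E' x (h(v := y - x))) \<le> \<epsilon> * norm (y - x) * tprod V h"
    using K[OF e'] unfolding mult.assoc[of \<epsilon>]
    by (rule eventually_mono)
      (meson Ke mult_right_mono order_trans mult_nonneg_nonneg norm_ge_zero tprod_nonneg)
qed

lemma tensor_contD:
  "tensor_cont V E \<Longrightarrow> \<epsilon> > 0 \<Longrightarrow> \<forall>\<^sub>F y in nhds x. \<forall>h. norm (E y h - E x h) \<le> \<epsilon> * tprod V h"
  unfolding tensor_cont_def by simp

lemma tensor_derivD:
  "tensor_deriv V v E E' \<Longrightarrow> \<epsilon> > 0 \<Longrightarrow>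
    \<forall>\<^sub>F y in nhds x. \<forall>h. norm (E y h - E x h - E' x (h(v := y - x))) \<le> \<epsilon> * norm (y - x) * tprod V h"
  unfolding tensor_deriv_def by simp

subsection \<open>Sums and renaming of variables\<close>

lemma tensor_add: "tensor V M \<Longrightarrow> tensor V M' \<Longrightarrow> tensor V (\<lambda>h. M h + M' h)"
proof -
  assume M: "tensor V M" and M': "tensor V M'"
  obtain B where B: "\<And>h. norm (M h) \<le> B * tprod V h" using tensor_boundE[OF M] by metis
  obtain B' where B': "\<And>h. norm (M' h) \<le> B' * tprod V h" using tensor_boundE[OF M'] by metis
  show ?thesis
  proof (rule tensorI[where B = "B + B'"])
    show "M h + M' h = M g + M' g" if "\<And>i. i \<in> V \<Longrightarrow> h i = g i" for h g
      using tensor_dep[OF M that] tensor_dep[OF M' that] by simp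
    show "norm (M h + M' h) \<le> (B + B') * tprod V h" for h
      using norm_triangle_mono[OF B B', of h h] by (simp add: distrib_right)
  qed (intro linear_compose_add tensor_linear[OF M] tensor_linear[OF M'])
qed

lemma tensor_minus: "tensor V M \<Longrightarrow> tensor V (\<lambda>h. - M h)"
  unfolding tensor_def by (simp add: linear_compose_neg)

lemma tensor_cont_add: 
  assumes "tensor_cont V E" "tensor_cont V F"
  shows "tensor_cont V (\<lambda>x h. E x h + F x h)"
proof (rule tensor_contI)
  fix x
  have "\<forall>\<^sub>F y in nhds x. \<forall>h. norm (E y h + F y h - (E x h + F x h)) \<le> 2 * \<epsilon> * tprod V h" if e: "\<epsilon> > 0" for \<epsilon> :: real
    using tensor_contD[OF assms(1) e] tensor_contD[OF assms(2) e]
  proof eventually_elim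
    case (elim y)
    have "norm (E y h + F y h - (E x h + F x h)) \<le> \<epsilon> * tprod V h + \<epsilon> * tprod V h" for h
      unfolding add_diff_add using elim by (intro norm_triangle_mono) auto
    then show ?case by (simp add: mult.assoc)
  qed
  then show "\<exists>K. \<forall>\<epsilon>. 0 < \<epsilon> \<longrightarrow> \<epsilon> \<le> 1 \<longrightarrow> (\<forall>\<^sub>F y in nhds x. \<forall>h.
      norm (E y h + F y h - (E x h + F x h)) \<le> K * \<epsilon> * tprod V h)" by blast
qed

lemma tensor_deriv_add:
  assumes "tensor_deriv V v E E'" "tensor_deriv V v F F'"
  shows "tensor_deriv V v (\<lambda>x h. E x h + F x h) (\<lambda>x h. E' x h + F' x h)"
proof (rule tensor_derivI)
  fix x
  have "\<forall>\<^sub>F y in nhds x. \<forall>h. norm (E y h + F y h - (E x h + F x h) - (E' x (h(v := y - x)) + F' x (h(v := y - x))))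
      \<le> 2 * \<epsilon> * (norm (y - x) * tprod V h)" if e: "\<epsilon> > 0" for \<epsilon> :: real
    using tensor_derivD[OF assms(1) e] tensor_derivD[OF assms(2) e]
  proof eventually_elim
    case (elim y)
    have "norm (E y h + F y h - (E x h + F x h) - (E' x (h(v := y - x)) + F' x (h(v := y - x))))
      \<le> \<epsilon> * norm (y - x) * tprod V h + \<epsilon> * norm (y - x) * tprod V h" for h
      unfolding add_diff_add using elim by (intro norm_triangle_mono) auto
    then show ?case by (simp add: mult_ac)
  qed
  then show "\<exists>K. \<forall>\<epsilon>. 0 < \<epsilon> \<longrightarrow> \<epsilon> \<le> 1 \<longrightarrow> (\<forall>\<^sub>F y in nhds x. \<forall>h.
      norm (E y h + F y h - (E x h + F x h) - (E' x (h(v := y - x)) + F' x (h(v := y - x))))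
      \<le> K * \<epsilon> * (norm (y - x) * tprod V h))" by blast
qed

lemma smooth_tensor_add:
  "smooth_tensor r V E \<Longrightarrow> smooth_tensor r V F \<Longrightarrow> smooth_tensor r V (\<lambda>x h. E x h + F x h)"
proof (induction r arbitrary: V E F)
  case 0
  then show ?case by (simp add: tensor_add tensor_cont_add)
next
  case (Suc r)
  show ?case unfolding smooth_tensor.simps(2)
  proof (intro conjI allI impI)
    fix v assume v: "v \<notin> V"
    obtain E' where E: "smooth_tensor r (insert v V) E'" "tensor_deriv V v E E'"
      by (rule smooth_tensor_derivE[OF Suc.prems(1) v])
    obtain F' where F: "smooth_tensor r (insert v V) F'" "tensor_deriv V v F F'"
      by (rule smooth_tensor_derivE[OF Suc.prems(2) v])
    show "\<exists>E'. smooth_tensor r (insert v V) E' \<and> tensor_deriv V v (\<lambda>x h. E x h + F x h) E'"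
      by (rule exI, rule conjI, rule Suc.IH[OF E(1) F(1)], rule tensor_deriv_add[OF E(2) F(2)])
  qed (simp_all only: tensor_add tensor_cont_add smooth_tensorD[OF Suc.prems(1)] smooth_tensorD[OF Suc.prems(2)])
qed

lemma tensor_cont_minus: "tensor_cont V E \<Longrightarrow> tensor_cont V (\<lambda>x h. - E x h)"
  unfolding tensor_cont_def by (simp only: norm_minus_commute minus_diff_minus norm_minus_cancel)

lemma tensor_deriv_minus: "tensor_deriv V v E E' \<Longrightarrow> tensor_deriv V v (\<lambda>x h. - E x h) (\<lambda>x h. - E' x h)"
  unfolding tensor_deriv_def by (simp only: minus_diff_minus norm_minus_cancel)

lemma smooth_tensor_minus:
  "smooth_tensor r V E \<Longrightarrow> smooth_tensor r V (\<lambda>x h. - E x h)"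
proof (induction r arbitrary: V E)
  case 0
  then show ?case by (simp add: tensor_minus tensor_cont_minus)
next
  case (Suc r)
  show ?case unfolding smooth_tensor.simps(2)
  proof (intro conjI allI impI)
    fix v assume v: "v \<notin> V"
    obtain E' where E: "smooth_tensor r (insert v V) E'" "tensor_deriv V v E E'"
      by (rule smooth_tensor_derivE[OF Suc.prems(1) v])
    show "\<exists>E'. smooth_tensor r (insert v V) E' \<and> tensor_deriv V v (\<lambda>x h. - E x h) E'"
      by (rule exI, rule conjI, rule Suc.IH[OF E(1)], rule tensor_deriv_minus[OF E(2)])
  qed (simp_all only: tensor_minus tensor_cont_minus smooth_tensorD[OF Suc.prems(1)])
qed

lemma tprod_rename: "inj p \<Longrightarrow> tprod (p ` V) h = tprod V (\<lambda>i. h (p i))"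
  unfolding tprod_def by (subst prod.reindex) (auto intro: inj_on_subset)

lemma fun_upd_rename: "inj p \<Longrightarrow> (\<lambda>i. (h(p j := u)) (p i)) = (\<lambda>i. h (p i))(j := u)"
  by (auto simp: fun_eq_iff dest: injD)

lemma tensor_rename:
  assumes p: "inj p" and M: "tensor V M"
  shows "tensor (p ` V) (\<lambda>h. M (\<lambda>i. h (p i)))"
proof -
  obtain B where B: "\<And>h. norm (M h) \<le> B * tprod V h" using tensor_boundE[OF M] by metis
  show ?thesis
  proof (rule tensorI)
    show "norm (M (\<lambda>i. h (p i))) \<le> B * tprod (p ` V) h" for h
      using B unfolding tprod_rename[OF p] .
    show "M (\<lambda>i. h (p i)) = M (\<lambda>i. g (p i))" if "\<And>i. i \<in> p ` V \<Longrightarrow> h i = g i" for h g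
      using that by (intro tensor_dep[OF M]) simp
    show "linear (\<lambda>u. M (\<lambda>i. (h(j := u)) (p i)))" if j: "j \<in> p ` V" for h j
    proof -
      obtain i where i: "i \<in> V" "j = p i" using j by blast
      show ?thesis unfolding i(2) fun_upd_rename[OF p] using M i(1) by (rule tensor_linear)
    qed
  qed
qed

text \<open>A direction \<open>v\<close> outside the renamed variables has to be \<open>p w\<close>
  with \<open>w\<close> outside \<open>V\<close>; surjectivity of \<open>p\<close> provides
  it.\<close>

lemma smooth_tensor_rename:
  assumes p: "bij p"
  shows "smooth_tensor r V E \<Longrightarrow> smooth_tensor r (p ` V) (\<lambda>x h. E x (\<lambda>i. h (p i)))"
proof (induction r arbitrary: V E)
  note inj = bij_is_inj[OF p]
  have cont: "tensor_cont V E \<Longrightarrow> tensor_cont (p ` V) (\<lambda>x h. E x (\<lambda>i. h (p i)))" for V and E :: "'a \<Rightarrow> (nat \<Rightarrow> 'a) \<Rightarrow> 'a"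
    unfolding tensor_cont_def tprod_rename[OF inj]
    by (intro allI impI, drule spec, drule spec, drule (1) mp, erule eventually_mono, rule allI, erule spec)
  {
    case 0
    then show ?case by (simp add: tensor_rename[OF inj] cont)
  next
    case (Suc r)
    show ?case unfolding smooth_tensor.simps(2)
    proof (intro conjI allI impI)
      fix v assume v: "v \<notin> p ` V"
      obtain w where w: "v = p w" using p by (metis bij_pointE)
      have wV: "w \<notin> V" using v w by blast
      obtain E' where E: "smooth_tensor r (insert w V) E'" "tensor_deriv V w E E'"
        by (rule smooth_tensor_derivE[OF Suc.prems(1) wV])
      have "smooth_tensor r (insert v (p ` V)) (\<lambda>x h. E' x (\<lambda>i. h (p i)))"
        using Suc.IH[OF E(1)] unfolding image_insert w .
      moreover have "tensor_deriv (p ` V) v (\<lambda>x h. E x (\<lambda>i. h (p i))) (\<lambda>x h. E' x (\<lambda>i. h (p i)))"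
        unfolding tensor_deriv_def w fun_upd_rename[OF inj] tprod_rename[OF inj]
        using E(2)[unfolded tensor_deriv_def]
        by - (intro allI impI, drule spec, drule spec, drule (1) mp, erule eventually_mono, rule allI, erule spec)
      ultimately show "\<exists>E'. smooth_tensor r (insert v (p ` V)) E' \<and>
          tensor_deriv (p ` V) v (\<lambda>x h. E x (\<lambda>i. h (p i))) E'" by (intro exI conjI)
    qed (simp_all only: tensor_rename[OF inj] cont smooth_tensorD[OF Suc.prems] finite_imageI)
  }
qed

subsection \<open>Substitution\<close>

text \<open>\<open>a\<close> may belong to \<open>W\<close>, so a variable can be replaced by an
  expression in itself, as in the chain rule. Disjointness from the other variables keeps the result
  linear in each.\<close>

lemma tensor_subst:
  assumes M: "tensor V M" and K: "tensor W K" and V: "finite V" "a \<in> V" and W: "finite W" "W \<inter> (V - {a}) = {}"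
  shows "tensor ((V - {a}) \<union> W) (\<lambda>h. M (h(a := K h)))"
proof -
  obtain B where B: "B \<ge> 0" "\<And>h. norm (M h) \<le> B * tprod V h" using tensor_boundE[OF M] by metis
  obtain C where C: "C \<ge> 0" "\<And>h. norm (K h) \<le> C * tprod W h" using tensor_boundE[OF K] by metis
  show ?thesis
  proof (rule tensorI)
    fix h g :: "nat \<Rightarrow> 'a" assume hg: "\<And>i. i \<in> (V - {a}) \<union> W \<Longrightarrow> h i = g i"
    have "K h = K g" by (rule tensor_dep[OF K]) (simp add: hg)
    then show "M (h(a := K h)) = M (g(a := K g))" by (intro tensor_dep[OF M]) (simp add: hg)
  next
    fix h :: "nat \<Rightarrow> 'a" and i assume i: "i \<in> (V - {a}) \<union> W"
    show "linear (\<lambda>u. M ((h(i := u))(a := K (h(i := u)))))"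
    proof (cases "i \<in> W")
      case True
      have "M ((h(i := u))(a := K (h(i := u)))) = M (h(a := K (h(i := u))))" for u
        using True W(2) by (intro tensor_dep[OF M]) auto
      then show ?thesis
        using linear_compose[OF tensor_linear[OF K True] tensor_linear[OF M V(2)], of h h] by (simp add: o_def)
    next
      case False
      then have i: "i \<in> V" "i \<noteq> a" using i by auto
      have "K (h(i := u)) = K h" for u using False by (intro tensor_dep[OF K]) auto
      then have "(h(i := u))(a := K (h(i := u))) = (h(a := K h))(i := u)" for u
        using i by (simp add: fun_upd_twist)
      then show ?thesis using tensor_linear[OF M i(1), of "h(a := K h)"] by simp
    qed
  next
    fix h :: "nat \<Rightarrow> 'a"
    have "norm (M (h(a := K h))) \<le> B * (norm (K h) * tprod (V - {a}) h)"
      using B(2)[of "h(a := K h)"] unfolding tprod_upd[OF V] .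
    also have "\<dots> \<le> B * ((C * tprod W h) * tprod (V - {a}) h)"
      by (intro mult_left_mono mult_right_mono C B) simp
    finally show "norm (M (h(a := K h))) \<le> B * C * tprod ((V - {a}) \<union> W) h"
      using V W by (simp add: tprod_Un mult.assoc)
  qed
qed

lemma tensor_cont_bound:
  assumes "tensor V (E x)" "tensor_cont V E"
  obtains B where "B \<ge> 0" "\<forall>\<^sub>F y in nhds x. \<forall>h. norm (E y h) \<le> B * tprod V h"
proof -
  obtain B where B: "B \<ge> 0" "\<And>h. norm (E x h) \<le> B * tprod V h" using tensor_boundE[OF assms(1)] by metis
  have "\<forall>\<^sub>F y in nhds x. \<forall>h. norm (E y h) \<le> (B + 1) * tprod V h"
    using tensor_contD[OF assms(2) zero_less_one]
  proof eventually_elim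
    case (elim y)
    have "norm (E x h + (E y h - E x h)) \<le> B * tprod V h + 1 * tprod V h" for h
      using elim B(2) by (intro norm_triangle_mono) auto
    then show ?case by (simp add: distrib_right)
  qed
  then show ?thesis using B(1) that[of "B + 1"] by simp
qed

text \<open>The change is split at \<open>E x\<close> with \<open>G y\<close> inserted: one part
  needs continuity of \<open>E\<close> and a local bound on \<open>G\<close>, the other linearity in
  \<open>a\<close> and continuity of \<open>G\<close>.\<close>

lemma tensor_cont_subst:
  assumes E: "\<And>x. tensor V (E x)" "tensor_cont V E" and G: "\<And>x. tensor W (G x)" "tensor_cont W G"
    and V: "finite V" "a \<in> V" and W: "finite W" "W \<inter> (V - {a}) = {}"
  shows "tensor_cont ((V - {a}) \<union> W) (\<lambda>x h. E x (h(a := G x h)))"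
proof (rule tensor_contI)
  fix x
  obtain B where B: "B \<ge> 0" "\<And>h. norm (E x h) \<le> B * tprod V h" using tensor_boundE[OF E(1)] by metis
  obtain C where C: "C \<ge> 0" "\<forall>\<^sub>F y in nhds x. \<forall>h. norm (G y h) \<le> C * tprod W h"
    by (rule tensor_cont_bound[OF G])
  have "\<forall>\<^sub>F y in nhds x. \<forall>h. norm (E y (h(a := G y h)) - E x (h(a := G x h)))
      \<le> (C + B) * \<epsilon> * tprod ((V - {a}) \<union> W) h" if e: "\<epsilon> > 0" for \<epsilon> :: real
    using tensor_contD[OF E(2) e] tensor_contD[OF G(2) e] C(2)
  proof eventually_elim
    case (elim y)
    show ?case
    proof
      fix h :: "nat \<Rightarrow> 'a"
      let ?P = "tprod (V - {a}) h"
      have "norm (E y (h(a := G y h)) - E x (h(a := G y h))) \<le> \<epsilon> * (norm (G y h) * ?P)"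
        using elim(1) unfolding tprod_upd[OF V, symmetric] by blast
      also have "\<dots> \<le> \<epsilon> * ((C * tprod W h) * ?P)"
        using elim(3) e by (intro mult_left_mono mult_right_mono) auto
      finally have 1: "norm (E y (h(a := G y h)) - E x (h(a := G y h))) \<le> C * \<epsilon> * (tprod W h * ?P)"
        by (simp add: mult_ac)
      have "norm (E x (h(a := G y h - G x h))) \<le> B * (norm (G y h - G x h) * ?P)"
        using B(2)[of "h(a := G y h - G x h)"] unfolding tprod_upd[OF V] .
      also have "\<dots> \<le> B * ((\<epsilon> * tprod W h) * ?P)"
        using elim(2) B(1) by (intro mult_left_mono mult_right_mono) auto
      finally have 2: "norm (E x (h(a := G y h)) - E x (h(a := G x h))) \<le> B * \<epsilon> * (tprod W h * ?P)"
        unfolding tensor_diff[OF E(1) V(2)] by (simp add: mult_ac)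
      have "norm ((E y (h(a := G y h)) - E x (h(a := G y h))) + (E x (h(a := G y h)) - E x (h(a := G x h))))
          \<le> C * \<epsilon> * (tprod W h * ?P) + B * \<epsilon> * (tprod W h * ?P)"
        by (intro norm_triangle_mono 1 2)
      then show "norm (E y (h(a := G y h)) - E x (h(a := G x h)))
          \<le> (C + B) * \<epsilon> * tprod ((V - {a}) \<union> W) h"
        using V W by (simp add: tprod_Un distrib_right)
    qed
  qed
  then show "\<exists>K. \<forall>\<epsilon>. 0 < \<epsilon> \<longrightarrow> \<epsilon> \<le> 1 \<longrightarrow> (\<forall>\<^sub>F y in nhds x. \<forall>h.
      norm (E y (h(a := G y h)) - E x (h(a := G x h))) \<le> K * \<epsilon> * tprod ((V - {a}) \<union> W) h)"
    by blast
qed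

text \<open>Product rule. The error consists of the remainder of \<open>E\<close> with
  \<open>G y\<close> inserted, the change from \<open>G y\<close> to \<open>G x\<close> inside
  \<open>E'\<close>, and the remainder of \<open>G\<close> inside \<open>E x\<close>; they
  contribute \<open>C\<close>, \<open>B'\<close> and \<open>B\<close> in this order.\<close>

lemma tensor_deriv_subst:
  assumes E: "\<And>x. tensor V (E x)" "tensor_deriv V v E E'" "\<And>x. tensor (insert v V) (E' x)"
    and G: "\<And>x. tensor W (G x)" "tensor_cont W G" "tensor_deriv W v G G'" 
    and V: "finite V" "a \<in> V" and W: "finite W" "W \<inter> (V - {a}) = {}"
    and v: "v \<notin> V" "v \<notin> W"
  shows "tensor_deriv ((V - {a}) \<union> W) v (\<lambda>x h. E x (h(a := G x h)))
    (\<lambda>x h. E' x (h(a := G x h)) + E x (h(a := G' x h)))"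
proof (rule tensor_derivI)
  fix x
  obtain B where B: "B \<ge> 0" "\<And>h. norm (E x h) \<le> B * tprod V h" using tensor_boundE[OF E(1)] by metis
  obtain B' where B': "B' \<ge> 0" "\<And>h. norm (E' x h) \<le> B' * tprod (insert v V) h"
    using tensor_boundE[OF E(3)] by metis
  obtain C where C: "C \<ge> 0" "\<forall>\<^sub>F y in nhds x. \<forall>h. norm (G y h) \<le> C * tprod W h"
    by (rule tensor_cont_bound[OF G(1,2)])
  have va: "v \<noteq> a" "a \<noteq> v" using v V by auto
  let ?D = "\<lambda>y h. E y (h(a := G y h)) - E x (h(a := G x h)) -
        (E' x ((h(v := y - x))(a := G x (h(v := y - x)))) + E x ((h(v := y - x))(a := G' x (h(v := y - x)))))"
  have "\<forall>\<^sub>F y in nhds x. \<forall>h. norm (?D y h)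
      \<le> (C + B' + B) * \<epsilon> * (norm (y - x) * tprod ((V - {a}) \<union> W) h)" if e: "\<epsilon> > 0" for \<epsilon> :: real
    using tensor_derivD[OF E(2) e] tensor_derivD[OF G(3) e] tensor_contD[OF G(2) e] C(2)
  proof eventually_elim
    case (elim y)
    show ?case
    proof
      fix h :: "nat \<Rightarrow> 'a"
      let ?P = "tprod (V - {a}) h" and ?d = "y - x"
      let ?h = "h(v := ?d)" and ?T = "norm (y - x) * (tprod W h * tprod (V - {a}) h)"
      have Gx: "G x ?h = G x h" using v by (intro tensor_dep[OF G(1)]) auto
      have Ev: "E x (?h(a := p)) = E x (h(a := p))" for p using v by (intro tensor_dep[OF E(1)]) auto
      have "norm (E y (h(a := G y h)) - E x (h(a := G y h)) - E' x ((h(a := G y h))(v := ?d)))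
        \<le> \<epsilon> * norm ?d * (norm (G y h) * ?P)"
        using elim(1) unfolding tprod_upd[OF V, symmetric] by blast
      also have "\<dots> \<le> \<epsilon> * norm ?d * ((C * tprod W h) * ?P)"
        using elim(4) e by (intro mult_left_mono mult_right_mono) auto
      finally have 1: "norm (E y (h(a := G y h)) - E x (h(a := G y h)) - E' x (?h(a := G y h))) \<le> C * \<epsilon> * ?T"
        using va by (simp add: mult_ac fun_upd_twist)
      have "norm (E' x (?h(a := G y h - G x h))) \<le> B' * (norm (G y h - G x h) * (norm ?d * ?P))"
      proof -
        have "insert v V - {a} = insert v (V - {a})" using va by auto
        then have "tprod (insert v V - {a}) ?h = norm ?d * ?P"
          using V v by (simp add: tprod_insert)
        moreover have "tprod (insert v V) (?h(a := G y h - G x h)) = norm (G y h - G x h) * tprod (insert v V - {a}) ?h"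
          using V by (intro tprod_upd) auto
        ultimately show ?thesis using B'(2)[of "?h(a := G y h - G x h)"] by metis
      qed
      also have "\<dots> \<le> B' * ((\<epsilon> * tprod W h) * (norm ?d * ?P))"
        using elim(3) B'(1) by (intro mult_left_mono mult_right_mono) auto
      finally have 2: "norm (E' x (?h(a := G y h)) - E' x (?h(a := G x h))) \<le> B' * \<epsilon> * ?T"
        using V unfolding tensor_diff[OF E(3) insertI2[OF V(2)]] by (simp add: mult_ac)
      have "norm (E x (h(a := G y h - G x h - G' x ?h))) \<le> B * (norm (G y h - G x h - G' x ?h) * ?P)"
        using B(2)[of "h(a := G y h - G x h - G' x ?h)"] unfolding tprod_upd[OF V] .
      also have "\<dots> \<le> B * ((\<epsilon> * norm ?d * tprod W h) * ?P)"
        using elim(2) B(1) by (intro mult_left_mono mult_right_mono) auto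
      finally have 3: "norm (E x (h(a := G y h)) - E x (h(a := G x h)) - E x (h(a := G' x ?h))) \<le> B * \<epsilon> * ?T"
        unfolding tensor_diff[OF E(1) V(2)] by (simp add: mult_ac)
      have D: "?D y h = (E y (h(a := G y h)) - E x (h(a := G y h)) - E' x (?h(a := G y h)))
          + (E' x (?h(a := G y h)) - E' x (?h(a := G x h)))
          + (E x (h(a := G y h)) - E x (h(a := G x h)) - E x (h(a := G' x ?h)))"
        unfolding Gx Ev by (simp add: algebra_simps)
      have "norm (?D y h) \<le> C * \<epsilon> * ?T + B' * \<epsilon> * ?T + B * \<epsilon> * ?T"
        unfolding D by (intro norm_triangle_mono 1 2 3)
      also have "\<dots> = (C + B' + B) * \<epsilon> * (norm (y - x) * tprod ((V - {a}) \<union> W) h)"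
        unfolding tprod_Un[OF finite_Diff[OF V(1)] W] by (simp only: distrib_right)
      finally show "norm (?D y h) \<le> (C + B' + B) * \<epsilon> * (norm (y - x) * tprod ((V - {a}) \<union> W) h)" .
    qed
  qed
  then show "\<exists>K. \<forall>\<epsilon>. 0 < \<epsilon> \<longrightarrow> \<epsilon> \<le> 1 \<longrightarrow> (\<forall>\<^sub>F y in nhds x. \<forall>h. norm (?D y h)
      \<le> K * \<epsilon> * (norm (y - x) * tprod ((V - {a}) \<union> W) h))"
    by blast
qed

text \<open>By the product rule the derivative is a sum of two substitutions of one order less,
  \<open>E'\<close> with \<open>G\<close> and \<open>E\<close> with \<open>G'\<close>; so the
  induction runs over all fields and index sets at once.\<close>

lemma smooth_tensor_subst:
  assumes "smooth_tensor r V E" "smooth_tensor r W G" "a \<in> V" "W \<inter> (V - {a}) = {}"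
  shows "smooth_tensor r ((V - {a}) \<union> W) (\<lambda>x h. E x (h(a := G x h)))"
  using assms
proof (induction r arbitrary: V E W G a)
  case 0
  note E = smooth_tensorD[OF 0(1)] and G = smooth_tensorD[OF 0(2)]
  show ?case unfolding smooth_tensor.simps(1)
    by (intro conjI allI tensor_subst tensor_cont_subst finite_UnI finite_Diff E G 0)
next
  case (Suc r)
  note E = smooth_tensorD[OF Suc.prems(1)] and G = smooth_tensorD[OF Suc.prems(2)]
  show ?case unfolding smooth_tensor.simps(2)
  proof (intro conjI allI impI)
    fix v assume v: "v \<notin> (V - {a}) \<union> W"
    \<comment> \<open>The bound variable \<open>a\<close> is renamed so that it differs from \<open>v\<close>.\<close>
    obtain b where b: "b \<notin> insert v (V \<union> W)" using ex_new_if_finite[of "insert v (V \<union> W)"] E G by auto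
    define p where "p = Transposition.transpose a b"
    define F where "F x h = E x (\<lambda>i. h (p i))" for x h
    have pV: "p ` V = insert b (V - {a})"
      using b Suc.prems(3) by (auto simp: p_def Transposition.transpose_def image_iff)
    have F: "smooth_tensor (Suc r) (insert b (V - {a})) F"
      using smooth_tensor_rename[OF _ Suc.prems(1), of p] unfolding pV F_def by (simp add: p_def)
    have EF: "E x (h(a := G x h)) = F x (h(b := G x h))" for x h
      unfolding F_def using b by (intro tensor_dep[OF E(2)]) (auto simp: p_def Transposition.transpose_def)
    let ?V = "insert b (V - {a})"
    have eq: "?V - {b} = V - {a}" using b by auto
    have bV: "b \<in> ?V" and vV: "v \<notin> ?V" "v \<notin> W" using b v by auto
    have WV: "W \<inter> (?V - {b}) = {}" unfolding eq by (rule Suc.prems)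
    obtain F' where F': "smooth_tensor r (insert v ?V) F'" "tensor_deriv ?V v F F'"
      by (rule smooth_tensor_derivE[OF F vV(1)])
    obtain G' where G': "smooth_tensor r (insert v W) G'" "tensor_deriv W v G G'"
      by (rule smooth_tensor_derivE[OF Suc.prems(2) vV(2)])
    have "smooth_tensor r ((insert v ?V - {b}) \<union> W) (\<lambda>x h. F' x (h(b := G x h)))"
      using WV vV by (intro Suc.IH F'(1) smooth_tensor_Suc_D[OF Suc.prems(2)]) auto
    moreover have "(insert v ?V - {b}) \<union> W = insert v ((V - {a}) \<union> W)" using eq b by auto
    moreover have "smooth_tensor r ((?V - {b}) \<union> insert v W) (\<lambda>x h. F x (h(b := G' x h)))"
      using WV vV by (intro Suc.IH smooth_tensor_Suc_D[OF F] G'(1)) auto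
    moreover have "(?V - {b}) \<union> insert v W = insert v ((V - {a}) \<union> W)" using eq by auto
    ultimately have "smooth_tensor r (insert v ((V - {a}) \<union> W)) (\<lambda>x h. F' x (h(b := G x h)) + F x (h(b := G' x h)))"
      by (simp add: smooth_tensor_add)
    moreover have "tensor_deriv ((?V - {b}) \<union> W) v (\<lambda>x h. F x (h(b := G x h)))
        (\<lambda>x h. F' x (h(b := G x h)) + F x (h(b := G' x h)))"
      by (intro tensor_deriv_subst smooth_tensorD[OF F] smooth_tensorD[OF F'(1)] F'(2) G G'(2) bV vV WV)
    ultimately show "\<exists>E'. smooth_tensor r (insert v ((V - {a}) \<union> W)) E' \<and>
        tensor_deriv ((V - {a}) \<union> W) v (\<lambda>x h. E x (h(a := G x h))) E'"
      unfolding eq EF by (intro exI conjI)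
  qed (intro tensor_subst tensor_cont_subst finite_UnI finite_Diff E G Suc.prems)+
qed

subsection \<open>Base change\<close>

lemma lipschitz_filterlim_nhds:
  fixes \<phi> :: "'a::real_normed_vector \<Rightarrow> 'b::real_normed_vector"
  assumes lip: "\<And>x y. norm (\<phi> y - \<phi> x) \<le> C * norm (y - x)"
  shows "filterlim \<phi> (nhds (\<phi> x)) (nhds x)"
proof -
  have "((\<lambda>y. \<phi> y - \<phi> x) \<longlongrightarrow> 0) (nhds x)"
  proof (rule Lim_null_comparison)
    show "\<forall>\<^sub>F y in nhds x. norm (\<phi> y - \<phi> x) \<le> C * norm (y - x)" using lip by (intro always_eventually allI)
    have "((\<lambda>y. C * norm (y - x)) \<longlongrightarrow> C * norm (x - x)) (nhds x)" by (intro tendsto_intros filterlim_ident)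
    then show "((\<lambda>y. C * norm (y - x)) \<longlongrightarrow> 0) (nhds x)" by simp
  qed
  then show ?thesis using Lim_null[of \<phi>] by blast
qed

text \<open>The derivative of \<open>\<phi>\<close> at \<open>x\<close> is given as a field
  \<open>R\<close> taken at \<open>\<phi> x\<close>. Hence the derivative of \<open>E\<close> along
  \<open>\<phi>\<close> is once more a field taken along \<open>\<phi>\<close>, of one order less,
  and the induction closes without any higher smoothness of \<open>\<phi>\<close>.\<close>

lemma smooth_tensor_base_change:
  fixes \<phi> :: "'a::real_normed_vector \<Rightarrow> 'a" and R :: "'a \<Rightarrow> 'a \<Rightarrow> 'a"
  assumes lip: "\<And>x y. norm (\<phi> y - \<phi> x) \<le> C * norm (y - x)"
    and deriv: "\<And>x \<epsilon>. \<epsilon> > 0 \<Longrightarrow> \<forall>\<^sub>F y in nhds x. norm (\<phi> y - \<phi> x - R (\<phi> x) (y - x)) \<le> \<epsilon> * norm (y - x)"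
    and R: "\<And>c. smooth_tensor r {c} (\<lambda>u h. R u (h c))"
    and E: "smooth_tensor r V E"
  shows "smooth_tensor r V (\<lambda>x. E (\<phi> x))"
proof -
  note lim = lipschitz_filterlim_nhds[OF lip]
  have cont: "tensor_cont V (\<lambda>x. E (\<phi> x))" if "tensor_cont V E" for V and E :: "'a \<Rightarrow> (nat \<Rightarrow> 'a) \<Rightarrow> 'a"
    unfolding tensor_cont_def
    by (intro allI impI eventually_compose_filterlim[OF tensor_contD[OF that] lim])
  show ?thesis using R E
  proof (induction r arbitrary: V E)
    case 0
    then show ?case by (simp add: cont)
  next
    case (Suc r)
    note E = smooth_tensorD[OF Suc.prems(2)]
    show ?case unfolding smooth_tensor.simps(2)
    proof (intro conjI allI impI)
      fix v assume v: "v \<notin> V"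
      obtain E' where E': "smooth_tensor r (insert v V) E'" "tensor_deriv V v E E'"
        by (rule smooth_tensor_derivE[OF Suc.prems(2) v])
      \<comment> \<open>Chain rule before composing with \<open>\<phi>\<close>: the direction
        \<open>v\<close> passes through \<open>R\<close> into \<open>E'\<close>.\<close>
      define F where "F x h = E' x (h(v := R x (h v)))" for x h
      have "smooth_tensor r ((insert v V - {v}) \<union> {v}) F"
        unfolding F_def by (intro smooth_tensor_subst[OF E'(1)] smooth_tensor_Suc_D[OF Suc.prems(1)]) auto
      moreover have "(insert v V - {v}) \<union> {v} = insert v V" by auto
      ultimately have "smooth_tensor r (insert v V) F" by simp
      then have "smooth_tensor r (insert v V) (\<lambda>x. F (\<phi> x))"
        by (intro Suc.IH smooth_tensor_Suc_D[OF Suc.prems(1)])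
      moreover have "tensor_deriv V v (\<lambda>x. E (\<phi> x)) (\<lambda>x. F (\<phi> x))"
      proof (rule tensor_derivI)
        fix x
        obtain B where B: "B \<ge> 0" "\<And>h. norm (E' (\<phi> x) h) \<le> B * tprod (insert v V) h"
          using tensor_boundE[OF smooth_tensorD(2)[OF E'(1)]] by metis
        let ?D = "\<lambda>y h. E (\<phi> y) h - E (\<phi> x) h - F (\<phi> x) (h(v := y - x))"
        have "\<forall>\<^sub>F y in nhds x. \<forall>h. norm (?D y h) \<le> (C + B) * \<epsilon> * (norm (y - x) * tprod V h)"
          if e: "\<epsilon> > 0" for \<epsilon> :: real
          using eventually_compose_filterlim[OF tensor_derivD[OF E'(2) e] lim] deriv[OF e]
        proof eventually_elim
          case (elim y)
          show ?case
          proof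
            fix h :: "nat \<Rightarrow> 'a"
            let ?d = "\<phi> y - \<phi> x" and ?e = "R (\<phi> x) (y - x)"
            have "norm (E (\<phi> y) h - E (\<phi> x) h - E' (\<phi> x) (h(v := ?d))) \<le> \<epsilon> * norm ?d * tprod V h"
              using elim(1) by blast
            also have "\<dots> \<le> \<epsilon> * (C * norm (y - x)) * tprod V h"
              using e by (intro mult_left_mono mult_right_mono lip) auto
            finally have 1: "norm (E (\<phi> y) h - E (\<phi> x) h - E' (\<phi> x) (h(v := ?d))) \<le> C * \<epsilon> * (norm (y - x) * tprod V h)"
              by (simp add: mult_ac)
            have "norm (E' (\<phi> x) (h(v := ?d - ?e))) \<le> B * (norm (?d - ?e) * tprod V h)"
              using B(2)[of "h(v := ?d - ?e)"] v E(1) by (simp add: tprod_insert)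
            also have "\<dots> \<le> B * ((\<epsilon> * norm (y - x)) * tprod V h)"
              using elim(2) B(1) by (intro mult_left_mono mult_right_mono) auto
            finally have 2: "norm (E' (\<phi> x) (h(v := ?d)) - E' (\<phi> x) (h(v := ?e))) \<le> B * \<epsilon> * (norm (y - x) * tprod V h)"
              unfolding tensor_diff[OF smooth_tensorD(2)[OF E'(1)] insertI1] by (simp add: mult_ac)
            have D: "?D y h = (E (\<phi> y) h - E (\<phi> x) h - E' (\<phi> x) (h(v := ?d)))
                + (E' (\<phi> x) (h(v := ?d)) - E' (\<phi> x) (h(v := ?e)))"
              by (simp add: F_def)
            have "norm (?D y h) \<le> C * \<epsilon> * (norm (y - x) * tprod V h) + B * \<epsilon> * (norm (y - x) * tprod V h)"
              unfolding D by (intro norm_triangle_mono 1 2)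
            then show "norm (?D y h) \<le> (C + B) * \<epsilon> * (norm (y - x) * tprod V h)"
              by (simp only: distrib_right)
          qed
        qed
        then show "\<exists>K. \<forall>\<epsilon>. 0 < \<epsilon> \<longrightarrow> \<epsilon> \<le> 1 \<longrightarrow> (\<forall>\<^sub>F y in nhds x. \<forall>h.
          norm (?D y h) \<le> K * \<epsilon> * (norm (y - x) * tprod V h))" by blast
      qed
      ultimately show "\<exists>E'. smooth_tensor r (insert v V) E' \<and> tensor_deriv V v (\<lambda>x. E (\<phi> x)) E'"
        by (intro exI conjI)
    qed (use E cont in auto)
  qed
qed

subsection \<open>Inverses\<close>

text \<open>The identity \<open>R y - R x = R y (P x - P y) R x\<close> and the uniform bound
  \<open>C\<close> give continuity. The derivative is \<open>- R P' R\<close>, a substitution built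
  from \<open>R\<close> and \<open>P'\<close>, so one more order of \<open>P\<close> yields one more
  order of \<open>R\<close>.\<close>

lemma smooth_tensor_inverse:
  fixes P R :: "'a::real_normed_vector \<Rightarrow> 'a \<Rightarrow> 'a"
  assumes P: "\<And>c. smooth_tensor r {c} (\<lambda>u h. P u (h c))"
    and lin: "\<And>u. linear (R u)" and PR: "\<And>u w. P u (R u w) = w" and RP: "\<And>u w. R u (P u w) = w"
    and C: "C \<ge> 0" "\<And>u w. norm (R u w) \<le> C * norm w"
  shows "smooth_tensor r {c} (\<lambda>u h. R u (h c))"
proof -
  have t: "tensor {c} (\<lambda>h. R u (h c))" for u c
    by (rule tensorI[where B = C]) (use lin C in auto)
  have R_diff: "R u (v - w) = R u v - R u w" for u v w
    using linear_diff[OF lin] .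
  have Rsub: "R y w - R x w = R y (P x (R x w) - P y (R x w))" for x y w
    unfolding R_diff RP PR ..
  have Rcont: "\<forall>\<^sub>F y in nhds x. \<forall>w. norm (R y w - R x w) \<le> C * C * \<epsilon> * norm w" if e: "\<epsilon> > 0" for x \<epsilon>
    using tensor_contD[OF smooth_tensorD(3)[OF P[of 0]] e]
  proof eventually_elim
    case (elim y)
    show ?case
    proof
      fix w
      have "norm (P y (R x w) - P x (R x w)) \<le> \<epsilon> * norm (R x w)"
        using elim[rule_format, of "\<lambda>_. R x w"] by simp
      also have "\<dots> \<le> \<epsilon> * (C * norm w)" using e C by simp
      finally have "C * norm (P x (R x w) - P y (R x w)) \<le> C * (\<epsilon> * (C * norm w))"
        unfolding norm_minus_commute[of "P x (R x w)"] using C(1) by (rule mult_left_mono)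
      then show "norm (R y w - R x w) \<le> C * C * \<epsilon> * norm w"
        unfolding Rsub using C(2)[of y "P x (R x w) - P y (R x w)"] by (simp add: mult_ac)
    qed
  qed
  have cont: "tensor_cont {c} (\<lambda>u h. R u (h c))" for c
  proof (rule tensor_contI)
    fix x
    have "\<forall>\<^sub>F y in nhds x. \<forall>h. norm (R y (h c) - R x (h c)) \<le> C * C * \<epsilon> * tprod {c} h" if "\<epsilon> > 0" for \<epsilon>
      unfolding tprod_singleton using Rcont[OF that] by (rule eventually_mono) blast
    then show "\<exists>K. \<forall>\<epsilon>. 0 < \<epsilon> \<longrightarrow> \<epsilon> \<le> 1 \<longrightarrow> (\<forall>\<^sub>F y in nhds x. \<forall>h. norm (R y (h c) - R x (h c)) \<le> K * \<epsilon> * tprod {c} h)"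
      by blast
  qed
  show ?thesis using P
  proof (induction r arbitrary: c)
    case 0
    show ?case by (simp add: t cont)
  next
    case (Suc r)
    have IH: "smooth_tensor r {b} (\<lambda>u h. R u (h b))" for b
      by (intro Suc.IH smooth_tensor_Suc_D[OF Suc.prems])
    show ?case unfolding smooth_tensor.simps(2)
    proof (intro conjI allI impI)
      fix v assume v: "v \<notin> {c}"
      obtain P' where P': "smooth_tensor r {v, c} P'" "tensor_deriv {c} v (\<lambda>u h. P u (h c)) P'"
        by (rule smooth_tensor_derivE[OF Suc.prems[of c] v])
      define Q where "Q x h = P' x (h(c := R x (h c)))" for x h
      have "smooth_tensor r (({v, c} - {c}) \<union> {c}) Q"
        unfolding Q_def by (intro smooth_tensor_subst[OF P'(1)] IH) auto
      moreover have "({v, c} - {c}) \<union> {c} = {v, c}" by auto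
      ultimately have Q: "smooth_tensor r {v, c} Q" by simp
      obtain b where b: "b \<notin> {v, c}" using ex_new_if_finite[of "{v, c}"] by auto
      have "smooth_tensor r (({b} - {b}) \<union> {v, c}) (\<lambda>x h. R x ((h(b := Q x h)) b))"
        by (intro smooth_tensor_subst[OF IH Q]) auto
      then have "smooth_tensor r {v, c} (\<lambda>x h. - R x (Q x h))"
        by (intro smooth_tensor_minus) simp
      moreover have "tensor_deriv {c} v (\<lambda>u h. R u (h c)) (\<lambda>x h. - R x (Q x h))"
      proof (rule tensor_derivI)
        fix x
        obtain B where B: "B \<ge> 0" "\<And>h. norm (Q x h) \<le> B * tprod {v, c} h"
          using tensor_boundE[OF smooth_tensorD(2)[OF Q]] by metis
        have "\<forall>\<^sub>F y in nhds x. \<forall>h. norm (R y (h c) - R x (h c) - - R x (Q x (h(v := y - x))))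
            \<le> (C * C + C * C * B) * \<epsilon> * (norm (y - x) * tprod {c} h)" if e: "\<epsilon> > 0" for \<epsilon>
          using tensor_derivD[OF P'(2) e] Rcont[OF e]
        proof eventually_elim
          case (elim y)
          show ?case
          proof
            fix h :: "nat \<Rightarrow> 'a"
            let ?d = "y - x"
            define w where "w = R x (h c)"
            define z where "z = P' x (h(c := w, v := ?d))"
            have zQ: "Q x (h(v := ?d)) = z"
              using v by (simp add: Q_def z_def w_def fun_upd_twist)
            have w: "norm w \<le> C * norm (h c)" unfolding w_def by (rule C)
            have "norm (P y w - P x w - z) \<le> \<epsilon> * norm ?d * norm w"
              using elim(1)[rule_format, of "h(c := w)"] by (simp add: z_def)
            also have "\<dots> \<le> \<epsilon> * norm ?d * (C * norm (h c))"
              using e by (intro mult_left_mono w) auto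
            finally have "C * norm (P y w - P x w - z) \<le> C * (\<epsilon> * norm ?d * (C * norm (h c)))"
              using C(1) by (rule mult_left_mono)
            with C(2)[of y "P y w - P x w - z"]
            have 1: "norm (- R y (P y w - P x w - z)) \<le> C * C * \<epsilon> * (norm ?d * norm (h c))"
              by (simp add: mult_ac)
            have z: "norm z \<le> B * (norm ?d * norm (h c))"
              using B(2)[of "h(v := ?d)"] v unfolding zQ by (simp add: tprod_insert)
            have "norm (R y z - R x z) \<le> C * C * \<epsilon> * norm z" using elim(2) by blast
            also have "\<dots> \<le> C * C * \<epsilon> * (B * (norm ?d * norm (h c)))"
              using e C(1) by (intro mult_left_mono z) auto
            finally have 2: "norm (- (R y z - R x z)) \<le> C * C * B * \<epsilon> * (norm ?d * norm (h c))"
              unfolding norm_minus_cancel by (simp add: mult_ac)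
            \<comment> \<open>Writing \<open>h c\<close> as \<open>P x w\<close> turns the error
              into the remainder of \<open>P\<close> seen through \<open>R y\<close>, plus the
              continuity defect of \<open>R\<close> at \<open>z\<close>.\<close>
            have D: "R y (h c) - R x (h c) - - R x z = - R y (P y w - P x w - z) + - (R y z - R x z)"
              unfolding R_diff RP w_def PR by simp
            have "norm (R y (h c) - R x (h c) - - R x z)
              \<le> C * C * \<epsilon> * (norm ?d * norm (h c)) + C * C * B * \<epsilon> * (norm ?d * norm (h c))"
              unfolding D by (intro norm_triangle_mono 1 2)
            then show "norm (R y (h c) - R x (h c) - - R x (Q x (h(v := y - x))))
              \<le> (C * C + C * C * B) * \<epsilon> * (norm (y - x) * tprod {c} h)"
              unfolding zQ tprod_singleton by (simp only: distrib_right)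
          qed
        qed
        then show "\<exists>K. \<forall>\<epsilon>. 0 < \<epsilon> \<longrightarrow> \<epsilon> \<le> 1 \<longrightarrow> (\<forall>\<^sub>F y in nhds x. \<forall>h.
            norm (R y (h c) - R x (h c) - - R x (Q x (h(v := y - x)))) \<le> K * \<epsilon> * (norm (y - x) * tprod {c} h))"
          by blast
      qed
      ultimately show "\<exists>E'. smooth_tensor r {v, c} E' \<and> tensor_deriv {c} v (\<lambda>u h. R u (h c)) E'"
        by (intro exI conjI)
    qed (simp_all add: t cont)
  qed
qed

text \<open>\<open>D j\<close> is the \<open>j\<close>-th derivative of \<open>D 0\<close>, which is itself \<open>m\<close>-linear in the variables below \<open>m\<close>.\<close>

definition derivative_tower :: "nat \<Rightarrow> nat \<Rightarrow> (nat \<Rightarrow> 'a::real_normed_vector \<Rightarrow> (nat \<Rightarrow> 'a) \<Rightarrow> 'a) \<Rightarrow> bool" where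
  "derivative_tower m k D \<longleftrightarrow>
     (\<forall>j\<le>k. (\<forall>x. tensor {..<m + j} (D j x)) \<and> tensor_cont {..<m + j} (D j)) \<and>
     (\<forall>j<k. tensor_deriv {..<m + j} (m + j) (D j) (D (Suc j)))"

lemma derivative_tower_Suc:
  assumes "\<And>x. tensor {..<m} (D 0 x)" "tensor_cont {..<m} (D 0)" "tensor_deriv {..<m} m (D 0) (D 1)"
    and "derivative_tower (Suc m) k (\<lambda>j. D (Suc j))"
  shows "derivative_tower m (Suc k) D"
  unfolding derivative_tower_def
proof (intro conjI allI impI)
  fix j assume "j \<le> Suc k"
  then show "tensor {..<m + j} (D j x)" "tensor_cont {..<m + j} (D j)" for x
    using assms(1,2,4) unfolding derivative_tower_def by (cases j; force)+
next
  fix j assume "j < Suc k"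
  then show "tensor_deriv {..<m + j} (m + j) (D j) (D (Suc j))"
    using assms(3,4) unfolding derivative_tower_def by (cases j; force)
qed

text \<open>The next number is always taken as the fresh direction, which reproduces the numbering
  of arguments in \<open>Ck_on\<close>.\<close>

lemma smooth_tensor_tower:
  "smooth_tensor r {..<m} E \<Longrightarrow> \<exists>D. D 0 = E \<and> derivative_tower m r D"
proof (induction r arbitrary: m E)
  case 0
  then show ?case by (intro exI[of _ "\<lambda>_. E"]) (simp add: derivative_tower_def)
next
  case (Suc r)
  obtain E' where E': "smooth_tensor r (insert m {..<m}) E'" "tensor_deriv {..<m} m E E'"
    by (rule smooth_tensor_derivE[OF Suc.prems, of m]) auto
  have "insert m {..<m} = {..<Suc m}" by auto
  with Suc.IH[of "Suc m" E'] E'(1) obtain D where D: "D 0 = E'" "derivative_tower (Suc m) r D" by auto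
  have "derivative_tower m (Suc r) (case_nat E D)"
    using smooth_tensorD[OF Suc.prems] E'(2) D by (intro derivative_tower_Suc) auto
  then show ?case by (intro exI[of _ "case_nat E D"]) simp
qed

text \<open>A tower differentiates only in the variable \<open>m\<close>; transposing
  \<open>m\<close> and \<open>v\<close> gives the derivative in any other fresh
  \<open>v\<close>.\<close>

lemma tower_smooth_tensor:
  "derivative_tower m r D \<Longrightarrow> smooth_tensor r {..<m} (D 0)"
proof (induction r arbitrary: m D)
  case 0
  then show ?case by (simp add: derivative_tower_def)
next
  case (Suc r)
  note T = Suc.prems[unfolded derivative_tower_def]
  have "derivative_tower (Suc m) r (\<lambda>j. D (Suc j))"
    unfolding derivative_tower_def
  proof (intro conjI allI impI)
    fix j assume "j < r"
    then show "tensor_deriv {..<Suc m + j} (Suc m + j) (D (Suc j)) (D (Suc (Suc j)))"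
      using T[THEN conjunct2, rule_format, of "Suc j"] by simp
  qed (use T[THEN conjunct1, rule_format, of "Suc j" for j] in simp_all)
  from Suc.IH[OF this] have D1: "smooth_tensor r {..<Suc m} (D 1)" by simp
  have t1: "tensor {..<Suc m} (D 1 x)" for x using smooth_tensorD(2)[OF D1] .
  have d: "tensor_deriv {..<m} m (D 0) (D 1)" using T by force
  show ?case unfolding smooth_tensor.simps(2)
  proof (intro conjI allI impI)
    fix v assume v: "v \<notin> {..<m}"
    define p where "p = Transposition.transpose m v"
    have "p ` {..<Suc m} = insert v {..<m}"
      using v by (auto simp: p_def Transposition.transpose_def image_iff lessThan_Suc)
    moreover have "smooth_tensor r (p ` {..<Suc m}) (\<lambda>x h. D 1 x (\<lambda>i. h (p i)))"
      by (intro smooth_tensor_rename D1) (simp add: p_def)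
    moreover have "D 1 x (\<lambda>i. (h(v := u)) (p i)) = D 1 x (h(m := u))" for x h u
      using v by (intro tensor_dep[OF t1]) (auto simp: p_def Transposition.transpose_def less_Suc_eq)
    ultimately show "\<exists>E'. smooth_tensor r (insert v {..<m}) E' \<and> tensor_deriv {..<m} v (D 0) E'"
      using d unfolding tensor_deriv_def by (intro exI[of _ "\<lambda>x h. D 1 x (\<lambda>i. h (p i))"]) simp
  qed (use T in force)+
qed

section \<open>Maps close to the identity and their inverses\<close>

text \<open>The Lipschitz constant of \<open>id - \<psi>\<close> passes to its derivative: compare
  the two along \<open>x + s v\<close> for small \<open>s\<close> and divide by
  \<open>s\<close>.\<close>

lemma derivative_near_identity:
  fixes \<psi> P :: "'a::real_normed_vector \<Rightarrow> 'a"
  assumes lin: "linear P"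
    and deriv: "\<And>\<epsilon>. \<epsilon> > 0 \<Longrightarrow> \<forall>\<^sub>F y in nhds x. norm (\<psi> y - \<psi> x - P (y - x)) \<le> \<epsilon> * norm (y - x)"
    and q: "\<And>y. norm ((y - \<psi> y) - (x - \<psi> x)) \<le> q * norm (y - x)"
  shows "norm (v - P v) \<le> q * norm v"
proof (cases "v = 0")
  case True
  then show ?thesis using linear_0[OF lin] by simp
next
  case False
  show ?thesis
  proof (rule field_le_epsilon)
    fix e :: real assume e: "e > 0"
    define \<epsilon> where "\<epsilon> = e / norm v"
    have "\<epsilon> > 0" using e False by (simp add: \<epsilon>_def)
    from deriv[OF this] obtain d where d: "d > 0"
      "\<And>y. dist y x < d \<Longrightarrow> norm (\<psi> y - \<psi> x - P (y - x)) \<le> \<epsilon> * norm (y - x)"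
      unfolding eventually_nhds_metric by metis
    define s where "s = d / (2 * norm v)"
    have s: "s > 0" "s * norm v < d" using d(1) False by (auto simp: s_def)
    let ?y = "x + s *\<^sub>R v"
    have 1: "norm (\<psi> ?y - \<psi> x - s *\<^sub>R P v) \<le> \<epsilon> * (s * norm v)"
      using d(2)[of ?y] s by (simp add: dist_norm linear_scale[OF lin])
    have 2: "norm ((?y - \<psi> ?y) - (x - \<psi> x)) \<le> q * (s * norm v)"
      using q[of ?y] s by simp
    have "s *\<^sub>R (v - P v) = ((?y - \<psi> ?y) - (x - \<psi> x)) + (\<psi> ?y - \<psi> x - s *\<^sub>R P v)"
      by (simp add: algebra_simps)
    then have "norm (s *\<^sub>R (v - P v)) \<le> q * (s * norm v) + \<epsilon> * (s * norm v)"
      using norm_triangle_mono[OF 2 1] by metis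
    then have "s * norm (v - P v) \<le> s * (q * norm v + \<epsilon> * norm v)"
      using s(1) unfolding norm_scaleR by (simp add: distrib_left mult_ac)
    then have "norm (v - P v) \<le> q * norm v + \<epsilon> * norm v"
      using s(1) by (rule mult_left_le_imp_le)
    then show "norm (v - P v) \<le> q * norm v + e" using False by (simp add: \<epsilon>_def)
  qed
qed

text \<open>\<open>f v = w\<close> holds exactly if \<open>v\<close> is fixed by the contraction
  sending \<open>v\<close> to \<open>v - f v + w\<close>.\<close>

lemma near_identity_bij:
  fixes f :: "'a::{real_normed_vector, complete_space} \<Rightarrow> 'a"
  assumes q: "0 \<le> q" "q < 1" and f: "\<And>x y. norm ((y - f y) - (x - f x)) \<le> q * norm (y - x)"
  shows "bij f" "(1 - q) * norm (y - x) \<le> norm (f y - f x)"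
proof -
  show low: "(1 - q) * norm (y - x) \<le> norm (f y - f x)" for x y
  proof -
    have "norm (((y - f y) - (x - f x)) + (f y - f x)) \<le> q * norm (y - x) + norm (f y - f x)"
      using f by (intro norm_triangle_mono) auto
    then show ?thesis by (simp add: algebra_simps)
  qed
  have "inj f"
  proof (rule injI)
    fix x y assume "f x = f y"
    then have "(1 - q) * norm (y - x) \<le> 0" using low[of y x] by simp
    then show "x = y" using q by (simp add: mult_le_0_iff)
  qed
  moreover have "surj f"
    unfolding surj_def
  proof
    fix w
    have "\<exists>!v. v \<in> UNIV \<and> v - f v + w = v"
    proof (rule Banach_fix)
      show "complete (UNIV :: 'a set)" by (rule complete_UNIV)
      show "dist (u - f u + w) (v - f v + w) \<le> q * dist u v" for u v
        using f[of u v] by (simp add: dist_norm)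
    qed (use q in auto)
    then obtain v where "v - f v + w = v" by blast
    then have "w = f v" by (simp add: algebra_simps)
    then show "\<exists>v. w = f v" ..
  qed
  ultimately show "bij f" by (rule bijI)
qed

text \<open>Each derivative \<open>P u\<close> is itself near the identity with the same
  \<open>q\<close>, hence invertible with the bound \<open>C\<close> for all \<open>u\<close> at
  once. This makes the argument global.\<close>

theorem derivative_tower_inverse:
  fixes \<psi> \<phi> :: "'a::{real_normed_vector, complete_space} \<Rightarrow> 'a"
  assumes T: "derivative_tower 0 (Suc k) D" and D0: "\<And>x h. D 0 x h = \<psi> x"
    and inv: "\<And>y. \<psi> (\<phi> y) = y"
    and q: "0 \<le> q" "q < 1" "\<And>x y. norm ((y - \<psi> y) - (x - \<psi> x)) \<le> q * norm (y - x)"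
  obtains D' where "derivative_tower 0 (Suc k) D'" "\<And>x h. D' 0 x h = \<phi> x"
proof -
  define C where "C = 1 / (1 - q)"
  have C: "C > 0" "C * (1 - q) = 1" using q by (auto simp: C_def)
  have "derivative_tower 1 k (\<lambda>j. D (Suc j))"
    unfolding derivative_tower_def
  proof (intro conjI allI impI)
    fix j assume "j < k"
    then show "tensor_deriv {..<1 + j} (1 + j) (D (Suc j)) (D (Suc (Suc j)))"
      using T[unfolded derivative_tower_def, THEN conjunct2, rule_format, of "Suc j"] by simp
  qed (use T[unfolded derivative_tower_def, THEN conjunct1, rule_format, of "Suc j" for j] in simp_all)
  from tower_smooth_tensor[OF this] have D1: "smooth_tensor k {0} (D 1)"
    by (simp add: lessThan_Suc)
  note t1 = smooth_tensorD(2)[OF D1]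
  \<comment> \<open>\<open>D 1 u\<close> reads only the variable 0, so a constant family turns it
    into a map of one vector.\<close>
  define P where "P u v = D 1 u (\<lambda>_. v)" for u v
  have DP: "D 1 u h = P u (h 0)" for u h
    unfolding P_def by (intro tensor_dep[OF t1]) simp
  have P_lin: "linear (P u)" for u
    using tensor_linear[OF t1, of 0 u "\<lambda>_. 0"] unfolding DP by simp
  have P: "smooth_tensor k {c} (\<lambda>u h. P u (h c))" for c
  proof -
    define p where "p = Transposition.transpose 0 c"
    have "smooth_tensor k (p ` {0}) (\<lambda>u h. D 1 u (\<lambda>i. h (p i)))"
      by (intro smooth_tensor_rename D1) (simp add: p_def)
    then show ?thesis by (simp add: DP p_def del: One_nat_def)
  qed
  have "tensor_deriv {} 0 (D 0) (D 1)"
    using T[unfolded derivative_tower_def, THEN conjunct2, rule_format, of 0] by simp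
  from tensor_derivD[OF this]
  have \<psi>_deriv: "\<forall>\<^sub>F y in nhds x. norm (\<psi> y - \<psi> x - P x (y - x)) \<le> \<epsilon> * norm (y - x)"
    if "\<epsilon> > 0" for x \<epsilon>
    using that by (simp add: D0 DP tprod_def del: One_nat_def)
  have P_near: "norm (v - P u v) \<le> q * norm v" for u v
    by (rule derivative_near_identity[OF P_lin \<psi>_deriv q(3)])
  have P_near': "norm ((y - P u y) - (x - P u x)) \<le> q * norm (y - x)" for u x y
    using P_near[of "y - x" u] by (simp add: linear_diff[OF P_lin] algebra_simps)
  define R where "R u = inv (P u)" for u
  have P_bij: "bij (P u)" for u using near_identity_bij(1)[OF q(1,2) P_near'] .
  have PR: "P u (R u w) = w" and RP: "R u (P u w) = w" for u w
    using P_bij[of u] by (simp_all add: R_def bij_is_surj surj_f_inv_f bij_is_inj inv_f_f)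
  have R_lin: "linear (R u)" for u
  proof (rule linearI)
    show "R u (x + y) = R u x + R u y" for x y
      using RP[of u "R u x + R u y"] by (simp add: linear_add[OF P_lin] PR)
    show "R u (c *\<^sub>R x) = c *\<^sub>R R u x" for c x
      using RP[of u "c *\<^sub>R R u x"] by (simp add: linear_scale[OF P_lin] PR)
  qed
  have low: "norm (y - x) \<le> C * norm (f y - f x)"
    if "\<And>x y. norm ((y - f y) - (x - f x)) \<le> q * norm (y - x)" for f :: "'a \<Rightarrow> 'a" and x y
    using near_identity_bij(2)[OF q(1,2) that, of y x] q(2) by (simp add: C_def field_simps)
  have R_bound: "norm (R u w) \<le> C * norm w" for u w
    using low[OF P_near', of "R u w" 0 u] by (simp add: PR linear_0[OF P_lin])
  have \<phi>_lip: "norm (\<phi> y - \<phi> x) \<le> C * norm (y - x)" for x y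
    using low[OF q(3), of "\<phi> y" "\<phi> x"] by (simp add: inv)
  note lim = lipschitz_filterlim_nhds[OF \<phi>_lip]
  have \<phi>_deriv: "\<forall>\<^sub>F y in nhds x. norm (\<phi> y - \<phi> x - R (\<phi> x) (y - x)) \<le> \<epsilon> * norm (y - x)"
    if e: "\<epsilon> > 0" for x \<epsilon>
  proof -
    \<comment> \<open>One factor \<open>C\<close> pays for the bound on \<open>R\<close>, the other
      for the Lipschitz constant of \<open>\<phi>\<close>.\<close>
    have "\<epsilon> / (C * C) > 0" using e C by simp
    from eventually_compose_filterlim[OF \<psi>_deriv[OF this] lim]
    show ?thesis
    proof eventually_elim
      case (elim y)
      let ?d = "\<phi> y - \<phi> x"
      have "?d - R (\<phi> x) (y - x) = R (\<phi> x) (- (\<psi> (\<phi> y) - \<psi> (\<phi> x) - P (\<phi> x) ?d))"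
        by (simp add: inv linear_diff[OF R_lin] RP)
      then have "norm (?d - R (\<phi> x) (y - x)) \<le> C * norm (- (\<psi> (\<phi> y) - \<psi> (\<phi> x) - P (\<phi> x) ?d))"
        using R_bound by metis
      also have "\<dots> \<le> C * (\<epsilon> / (C * C) * norm ?d)"
        unfolding norm_minus_cancel using elim C(1) by (intro mult_left_mono) auto
      also have "\<dots> \<le> C * (\<epsilon> / (C * C) * (C * norm (y - x)))"
        using C(1) e by (intro mult_left_mono \<phi>_lip) auto
      also have "\<dots> = \<epsilon> * norm (y - x)" using C(1) by simp
      finally show ?case .
    qed
  qed
  have R: "smooth_tensor k {c} (\<lambda>u h. R u (h c))" for c
    using C(1) by (intro smooth_tensor_inverse[OF P R_lin PR RP _ R_bound]) simp
  have "smooth_tensor k {0} (\<lambda>x h. R (\<phi> x) (h 0))"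
    by (rule smooth_tensor_base_change[OF \<phi>_lip \<phi>_deriv R R])
  then have "smooth_tensor k {..<1} (\<lambda>x h. R (\<phi> x) (h 0))" by (simp add: lessThan_Suc)
  then obtain S where S: "S 0 = (\<lambda>x h. R (\<phi> x) (h 0))" "derivative_tower 1 k S"
    using smooth_tensor_tower by blast
  \<comment> \<open>Putting \<open>\<phi>\<close> below the tower of its derivative raises the order
    from \<open>k\<close> to \<open>Suc k\<close>.\<close>
  have "derivative_tower 0 (Suc k) (case_nat (\<lambda>x h. \<phi> x) S)"
  proof (rule derivative_tower_Suc)
    show "tensor {..<0} (case_nat (\<lambda>x h. \<phi> x) S 0 x)" for x
      by (rule tensorI[where B = "norm (\<phi> x)"]) (auto simp: tprod_def)
    show "tensor_cont {..<0} (case_nat (\<lambda>x h. \<phi> x) S 0)"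
      unfolding tensor_cont_def
    proof (intro allI impI)
      fix x and \<epsilon> :: real assume "\<epsilon> > 0"
      from tendstoD[OF lim this, of x]
      show "\<forall>\<^sub>F y in nhds x. \<forall>h. norm (case_nat (\<lambda>x h. \<phi> x) S 0 y h - case_nat (\<lambda>x h. \<phi> x) S 0 x h)
          \<le> \<epsilon> * tprod {..<0} h"
        by (rule eventually_mono) (simp add: tprod_def dist_norm)
    qed
    show "tensor_deriv {..<0} 0 (case_nat (\<lambda>x h. \<phi> x) S 0) (case_nat (\<lambda>x h. \<phi> x) S 1)"
      unfolding tensor_deriv_def using \<phi>_deriv by (simp add: S(1) tprod_def)
    show "derivative_tower (Suc 0) k (\<lambda>j. case_nat (\<lambda>x h. \<phi> x) S (Suc j))"
      using S(2) by simp
  qed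
  then show thesis by (rule that) simp
qed

section \<open>Continuously differentiable maps between subspaces\<close>

text \<open>\<open>Ck_on\<close> with the operator norms of multilinear maps replaced by explicit bounds.\<close>

definition Ck_family ::
  "('a::real_vector \<Rightarrow> real) \<Rightarrow> ('b::real_vector \<Rightarrow> real) \<Rightarrow> 'a set \<Rightarrow> nat \<Rightarrow> ('a \<Rightarrow> 'b) \<Rightarrow>
    (nat \<Rightarrow> 'a \<Rightarrow> (nat \<Rightarrow> 'a) \<Rightarrow> 'b) \<Rightarrow> bool" where
  "Ck_family nA nB S k f D \<longleftrightarrow>
     (\<forall>x\<in>S. \<forall>h. D 0 x h = f x) \<and>
     (\<forall>j\<le>k. \<forall>x\<in>S. ml_bounded nA nB S j (D j x)) \<and>
     (\<forall>j<k. \<forall>x\<in>S. \<forall>\<epsilon>>0. \<exists>\<delta>>0. \<forall>y\<in>S. nA (y - x) < \<delta> \<longrightarrow> (\<forall>h. (\<forall>i<j. h i \<in> S) \<longrightarrow>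
        nB (D j y h - D j x h - D (Suc j) x (h(j := y - x))) \<le> \<epsilon> * nA (y - x) * (\<Prod>i<j. nA (h i)))) \<and>
     (\<forall>j\<le>k. \<forall>x\<in>S. \<forall>\<epsilon>>0. \<exists>\<delta>>0. \<forall>y\<in>S. nA (y - x) < \<delta> \<longrightarrow> (\<forall>h. (\<forall>i<j. h i \<in> S) \<longrightarrow>
        nB (D j y h - D j x h) \<le> \<epsilon> * (\<Prod>i<j. nA (h i))))"

text \<open>Homogeneity and definiteness are asked on \<open>S\<close> only: the graph norm behaves
  well on \<open>D\<close>, outside of which \<open>L\<close> is arbitrary.\<close>

locale subspace_norm =
  fixes S :: "'a::real_vector set" and nA :: "'a \<Rightarrow> real"
  assumes sub: "subspace S"
    and nonneg: "\<And>x. 0 \<le> nA x"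
    and scale: "\<And>c x. x \<in> S \<Longrightarrow> nA (c *\<^sub>R x) = \<bar>c\<bar> * nA x"
    and eq_0: "\<And>x. x \<in> S \<Longrightarrow> nA x = 0 \<Longrightarrow> x = 0"
begin

lemma norm_0 [simp]: "nA 0 = 0"
  using scale[of 0 0] subspace_0[OF sub] by simp

lemma ml_norm_le:
  assumes B: "B \<ge> 0" "\<And>h. (\<forall>i<j. h i \<in> S) \<Longrightarrow> nB (M h) \<le> B * (\<Prod>i<j. nA (h i))"
  shows "ml_norm nA nB S j M \<le> B"
  unfolding ml_norm_def
proof (rule cSup_least)
  show "{nB (M h) |h. \<forall>i<j. h i \<in> S \<and> nA (h i) \<le> 1} \<noteq> {}"
    using subspace_0[OF sub] by (auto intro!: exI[of _ "\<lambda>_. 0"])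
  fix r assume "r \<in> {nB (M h) |h. \<forall>i<j. h i \<in> S \<and> nA (h i) \<le> 1}"
  then obtain h where h: "r = nB (M h)" "\<forall>i<j. h i \<in> S \<and> nA (h i) \<le> 1" by blast
  have "(\<Prod>i<j. nA (h i)) \<le> 1" using h nonneg by (intro prod_le_1) auto
  then have "B * (\<Prod>i<j. nA (h i)) \<le> B" using B(1) by (rule mult_left_le)
  then show "r \<le> B" using B(2)[of h] h by force
qed

lemma ml_bounded_scale:
  assumes M: "ml_bounded nA nB S j M" and h: "\<forall>i<j. h i \<in> S" and "m \<le> j"
  shows "M (\<lambda>i. if i < m then c i *\<^sub>R h i else h i) = (\<Prod>i<m. c i) *\<^sub>R M h"
  using \<open>m \<le> j\<close>
proof (induction m)
  case (Suc m)
  let ?g = "\<lambda>i. if i < m then c i *\<^sub>R h i else h i"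
  have g: "\<forall>l<j. ?g l \<in> S" using h by (simp add: subspace_scale[OF sub])
  have lin: "M (?g(m := a *\<^sub>R u + b *\<^sub>R v)) = a *\<^sub>R M (?g(m := u)) + b *\<^sub>R M (?g(m := v))"
    if "u \<in> S" "v \<in> S" for a b u v
    using M Suc.prems g that unfolding ml_bounded_def by (simp add: Suc_le_eq)
  \<comment> \<open>\<open>ml_bounded\<close> states linearity for combinations of two vectors;
    scaling is the case of second coefficient 0.\<close>
  have e1: "(\<lambda>i. if i < Suc m then c i *\<^sub>R h i else h i) = ?g(m := c m *\<^sub>R h m + 0 *\<^sub>R h m)"
    by (auto simp: fun_eq_iff less_Suc_eq)
  have e2: "M (?g(m := c m *\<^sub>R h m + 0 *\<^sub>R h m)) = c m *\<^sub>R M (?g(m := h m))"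
    using lin[of "h m" "h m" "c m" 0] h Suc.prems by simp
  have e3: "?g(m := h m) = ?g" by (auto simp: fun_eq_iff)
  have e4: "M ?g = (\<Prod>i<m. c i) *\<^sub>R M h" using Suc by simp
  show ?case unfolding e1 e2 unfolding e3 unfolding e4 by (simp add: mult.commute)
qed simp

text \<open>Arguments are normalised to length at most 1. Boundedness of \<open>M\<close> ensures
  that the real \<open>Sup\<close> in \<open>ml_norm\<close> is an upper bound.\<close>

lemma ml_norm_bound:
  fixes M :: "(nat \<Rightarrow> 'a) \<Rightarrow> 'b::real_normed_vector"
  assumes M: "ml_bounded nA norm S j M" and h: "\<forall>i<j. h i \<in> S"
  shows "norm (M h) \<le> ml_norm nA norm S j M * (\<Prod>i<j. nA (h i))"
proof -
  define c where "c i = nA (h i)" for i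
  \<comment> \<open>For \<open>c i = 0\<close> division by zero gives \<open>g i = 0\<close>; then
    \<open>h i = 0\<close> by \<open>eq_0\<close>, so \<open>h i = c i *\<^sub>R g i\<close> holds
    in this case too.\<close>
  define g where "g i = (1 / c i) *\<^sub>R h i" for i
  have gS: "\<forall>i<j. g i \<in> S" using h by (simp add: g_def subspace_scale[OF sub])
  have g1: "nA (g i) \<le> 1" if "i < j" for i
    using scale[of "h i" "1 / c i"] h that nonneg[of "h i"] by (simp add: g_def c_def)
  have "M h = M (\<lambda>i. if i < j then c i *\<^sub>R g i else g i)"
  proof -
    have "h i = c i *\<^sub>R g i" if "i < j" for i
      using eq_0[of "h i"] h that by (cases "c i = 0") (auto simp: g_def c_def)
    then show ?thesis using M unfolding ml_bounded_def by simp
  qed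
  also have "\<dots> = (\<Prod>i<j. c i) *\<^sub>R M g" using ml_bounded_scale[OF M gS] by simp
  finally have "norm (M h) = (\<Prod>i<j. c i) * norm (M g)"
    using nonneg by (simp add: c_def prod_nonneg abs_of_nonneg)
  also have "\<dots> \<le> (\<Prod>i<j. c i) * ml_norm nA norm S j M"
  proof (rule mult_left_mono)
    obtain B where B: "\<And>h. (\<forall>i<j. h i \<in> S) \<Longrightarrow> norm (M h) \<le> B * (\<Prod>i<j. nA (h i))"
      using M unfolding ml_bounded_def by blast
    show "norm (M g) \<le> ml_norm nA norm S j M"
      unfolding ml_norm_def
    proof (rule cSup_upper)
      show "norm (M g) \<in> {norm (M h) |h. \<forall>i<j. h i \<in> S \<and> nA (h i) \<le> 1}" using gS g1 by blast
      show "bdd_above {norm (M h) |h. \<forall>i<j. h i \<in> S \<and> nA (h i) \<le> 1}"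
      proof (rule bdd_aboveI)
        fix r assume "r \<in> {norm (M h) |h. \<forall>i<j. h i \<in> S \<and> nA (h i) \<le> 1}"
        then obtain h where h: "r = norm (M h)" "\<forall>i<j. h i \<in> S \<and> nA (h i) \<le> 1" by blast
        have "(\<Prod>i<j. nA (h i)) \<le> 1" "0 \<le> (\<Prod>i<j. nA (h i))"
          using h nonneg by (auto intro!: prod_le_1 prod_nonneg)
        then have "B * (\<Prod>i<j. nA (h i)) \<le> \<bar>B\<bar>"
          by (metis abs_ge_self abs_ge_zero mult_left_le mult_right_mono order_trans)
        then show "r \<le> \<bar>B\<bar>" using B[of h] h by force
      qed
    qed
  qed (simp add: c_def prod_nonneg nonneg)
  finally show ?thesis by (simp add: c_def mult.commute)
qed

lemma ml_bounded_diff: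
  fixes M N :: "(nat \<Rightarrow> 'a) \<Rightarrow> 'b::real_normed_vector"
  assumes M: "ml_bounded nA norm S j M" and N: "ml_bounded nA norm S j N"
  shows "ml_bounded nA norm S j (\<lambda>h. M h - N h)"
  unfolding ml_bounded_def
proof (intro conjI allI ballI impI)
  note M = M[unfolded ml_bounded_def] and N = N[unfolded ml_bounded_def]
  show "M h - N h = M h' - N h'" if "\<forall>i<j. h i = h' i" for h h'
    using M[THEN conjunct1, rule_format, of h h'] N[THEN conjunct1, rule_format, of h h'] that by simp
  show "M (h(i := a *\<^sub>R u + b *\<^sub>R v)) - N (h(i := a *\<^sub>R u + b *\<^sub>R v)) =
      a *\<^sub>R (M (h(i := u)) - N (h(i := u))) + b *\<^sub>R (M (h(i := v)) - N (h(i := v)))"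
    if "i < j" "u \<in> S" "v \<in> S" "\<forall>l<j. h l \<in> S" for h i u v a b
  proof -
    have "M (h(i := a *\<^sub>R u + b *\<^sub>R v)) = a *\<^sub>R M (h(i := u)) + b *\<^sub>R M (h(i := v))"
      "N (h(i := a *\<^sub>R u + b *\<^sub>R v)) = a *\<^sub>R N (h(i := u)) + b *\<^sub>R N (h(i := v))"
      using M N that by simp_all
    then show ?thesis by (simp add: scaleR_diff_right)
  qed
  obtain B where B: "\<And>h. (\<forall>i<j. h i \<in> S) \<Longrightarrow> norm (M h) \<le> B * (\<Prod>i<j. nA (h i))"
    using M by blast
  obtain C where C: "\<And>h. (\<forall>i<j. h i \<in> S) \<Longrightarrow> norm (N h) \<le> C * (\<Prod>i<j. nA (h i))"
    using N by blast
  have "norm (M h - N h) \<le> (B + C) * (\<Prod>i<j. nA (h i))" if "\<forall>i<j. h i \<in> S" for h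
    using B[OF that] C[OF that] norm_triangle_ineq4[of "M h" "N h"] by (simp add: distrib_right)
  then show "\<exists>B. \<forall>h. (\<forall>i<j. h i \<in> S) \<longrightarrow> norm (M h - N h) \<le> B * (\<Prod>i<j. nA (h i))" by blast
qed

text \<open>Freezing the last argument makes the remainder in \<open>Ck_on\<close> a
  \<open>j\<close>-linear map, to which \<open>ml_norm_bound\<close> applies.\<close>

lemma ml_bounded_upd:
  assumes M: "ml_bounded nA nB S (Suc j) M" and w: "w \<in> S"
  shows "ml_bounded nA nB S j (\<lambda>h. M (h(j := w)))"
  unfolding ml_bounded_def
proof (intro conjI allI ballI impI)
  note M = M[unfolded ml_bounded_def]
  show "M (h(j := w)) = M (h'(j := w))" if "\<forall>i<j. h i = h' i" for h h'
    by (rule M[THEN conjunct1, rule_format]) (use that in \<open>auto simp: less_Suc_eq\<close>)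
  show "M ((h(i := a *\<^sub>R u + b *\<^sub>R v))(j := w)) = a *\<^sub>R M ((h(i := u))(j := w)) + b *\<^sub>R M ((h(i := v))(j := w))"
    if "i < j" "u \<in> S" "v \<in> S" "\<forall>l<j. h l \<in> S" for h i u v a b
  proof -
    have "M ((h(j := w))(i := a *\<^sub>R u + b *\<^sub>R v)) = a *\<^sub>R M ((h(j := w))(i := u)) + b *\<^sub>R M ((h(j := w))(i := v))"
      by (rule M[THEN conjunct2, THEN conjunct1, rule_format]) (use that w in \<open>auto simp: less_Suc_eq\<close>)
    then show ?thesis using that(1) by (simp add: fun_upd_twist[of i j])
  qed
  obtain B where B: "\<And>h. (\<forall>i<Suc j. h i \<in> S) \<Longrightarrow> nB (M h) \<le> B * (\<Prod>i<Suc j. nA (h i))"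
    using M by blast
  have "nB (M (h(j := w))) \<le> (B * nA w) * (\<Prod>i<j. nA (h i))" if "\<forall>i<j. h i \<in> S" for h
    using B[of "h(j := w)"] that w by (simp add: less_Suc_eq mult_ac)
  then show "\<exists>B. \<forall>h. (\<forall>i<j. h i \<in> S) \<longrightarrow> nB (M (h(j := w))) \<le> B * (\<Prod>i<j. nA (h i))" by blast
qed

lemma Ck_on_family:
  fixes f :: "'a \<Rightarrow> 'b::real_normed_vector"
  assumes "Ck_on nA norm S k f"
  obtains D where "Ck_family nA norm S k f D"
proof -
  obtain D where D0: "\<forall>x\<in>S. \<forall>h. D 0 x h = f x"
    and ml: "\<forall>j\<le>k. \<forall>x\<in>S. ml_bounded nA norm S j (D j x)"
    and d: "\<forall>j<k. \<forall>x\<in>S. \<forall>\<epsilon>>0. \<exists>\<delta>>0. \<forall>y\<in>S. nA (y - x) < \<delta> \<longrightarrow>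
        ml_norm nA norm S j (\<lambda>h. D j y h - D j x h - D (Suc j) x (h(j := y - x))) \<le> \<epsilon> * nA (y - x)"
    and c: "\<forall>j\<le>k. \<forall>x\<in>S. \<forall>\<epsilon>>0. \<exists>\<delta>>0. \<forall>y\<in>S. nA (y - x) < \<delta> \<longrightarrow>
        ml_norm nA norm S j (\<lambda>h. D j y h - D j x h) \<le> \<epsilon>"
    using assms unfolding Ck_on_def by (elim exE conjE) (rule that)
  have "Ck_family nA norm S k f D"
    unfolding Ck_family_def
  proof (intro conjI D0 ml allI ballI impI)
    fix j x and \<epsilon> :: real assume j: "j < k" and x: "x \<in> S" and e: "\<epsilon> > 0"
    from d[rule_format, OF j x e] obtain \<delta> where \<delta>: "\<delta> > 0" "\<forall>y\<in>S. nA (y - x) < \<delta> \<longrightarrow>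
        ml_norm nA norm S j (\<lambda>h. D j y h - D j x h - D (Suc j) x (h(j := y - x))) \<le> \<epsilon> * nA (y - x)"
      by (elim exE conjE) (rule that)
    show "\<exists>\<delta>>0. \<forall>y\<in>S. nA (y - x) < \<delta> \<longrightarrow> (\<forall>h. (\<forall>i<j. h i \<in> S) \<longrightarrow>
        norm (D j y h - D j x h - D (Suc j) x (h(j := y - x))) \<le> \<epsilon> * nA (y - x) * (\<Prod>i<j. nA (h i)))"
    proof (intro exI conjI ballI impI allI)
      fix y h assume y: "y \<in> S" "nA (y - x) < \<delta>" and h: "\<forall>i<j. h i \<in> S"
      have "ml_bounded nA norm S j (\<lambda>h. D j y h - D j x h - D (Suc j) x (h(j := y - x)))"
        using ml j x y by (intro ml_bounded_diff ml_bounded_upd) (auto simp: subspace_diff[OF sub])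
      from ml_norm_bound[OF this h]
      show "norm (D j y h - D j x h - D (Suc j) x (h(j := y - x))) \<le> \<epsilon> * nA (y - x) * (\<Prod>i<j. nA (h i))"
        by (rule order_trans) (intro mult_right_mono \<delta>(2)[rule_format] y prod_nonneg nonneg)
    qed (rule \<delta>(1))
  next
    fix j x and \<epsilon> :: real assume j: "j \<le> k" and x: "x \<in> S" and e: "\<epsilon> > 0"
    from c[rule_format, OF j x e] obtain \<delta> where \<delta>: "\<delta> > 0" "\<forall>y\<in>S. nA (y - x) < \<delta> \<longrightarrow>
        ml_norm nA norm S j (\<lambda>h. D j y h - D j x h) \<le> \<epsilon>"
      by (elim exE conjE) (rule that)
    show "\<exists>\<delta>>0. \<forall>y\<in>S. nA (y - x) < \<delta> \<longrightarrow> (\<forall>h. (\<forall>i<j. h i \<in> S) \<longrightarrow>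
        norm (D j y h - D j x h) \<le> \<epsilon> * (\<Prod>i<j. nA (h i)))"
    proof (intro exI conjI ballI impI allI)
      fix y h assume y: "y \<in> S" "nA (y - x) < \<delta>" and h: "\<forall>i<j. h i \<in> S"
      have "ml_bounded nA norm S j (\<lambda>h. D j y h - D j x h)"
        using ml j x y by (intro ml_bounded_diff) auto
      from ml_norm_bound[OF this h]
      show "norm (D j y h - D j x h) \<le> \<epsilon> * (\<Prod>i<j. nA (h i))"
        by (rule order_trans) (intro mult_right_mono \<delta>(2)[rule_format] y prod_nonneg nonneg)
    qed (rule \<delta>(1))
  qed
  then show thesis by (rule that)
qed

lemma Ck_family_Ck_on:
  assumes F: "Ck_family nA nB S k f D"
  shows "Ck_on nA nB S k f"
  unfolding Ck_on_def
proof (intro exI[of _ D] conjI allI ballI impI)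
  note F = F[unfolded Ck_family_def]
  show "D 0 x h = f x" if "x \<in> S" for x h using F that by simp
  show "ml_bounded nA nB S j (D j x)" if "j \<le> k" "x \<in> S" for j x using F that by simp
  fix j x and \<epsilon> :: real assume x: "x \<in> S" and e: "\<epsilon> > 0"
  show "\<exists>\<delta>>0. \<forall>y\<in>S. nA (y - x) < \<delta> \<longrightarrow>
        ml_norm nA nB S j (\<lambda>h. D j y h - D j x h - D (Suc j) x (h(j := y - x))) \<le> \<epsilon> * nA (y - x)" if j: "j < k"
  proof -
    from F[THEN conjunct2, THEN conjunct2, THEN conjunct1, rule_format, OF j x e]
    obtain \<delta> where \<delta>: "\<delta> > 0" "\<forall>y\<in>S. nA (y - x) < \<delta> \<longrightarrow> (\<forall>h. (\<forall>i<j. h i \<in> S) \<longrightarrow>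
        nB (D j y h - D j x h - D (Suc j) x (h(j := y - x))) \<le> \<epsilon> * nA (y - x) * (\<Prod>i<j. nA (h i)))"
      by (elim exE conjE) (rule that)
    show ?thesis
      using e by (intro exI[of _ \<delta>] conjI ballI impI \<delta>(1) ml_norm_le \<delta>(2)[THEN bspec, THEN mp, THEN spec, THEN mp] mult_nonneg_nonneg nonneg) auto
  qed
  show "\<exists>\<delta>>0. \<forall>y\<in>S. nA (y - x) < \<delta> \<longrightarrow>
        ml_norm nA nB S j (\<lambda>h. D j y h - D j x h) \<le> \<epsilon>" if j: "j \<le> k"
  proof -
    from F[THEN conjunct2, THEN conjunct2, THEN conjunct2, rule_format, OF j x e]
    obtain \<delta> where \<delta>: "\<delta> > 0" "\<forall>y\<in>S. nA (y - x) < \<delta> \<longrightarrow> (\<forall>h. (\<forall>i<j. h i \<in> S) \<longrightarrow>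
        nB (D j y h - D j x h) \<le> \<epsilon> * (\<Prod>i<j. nA (h i)))"
      by (elim exE conjE) (rule that)
    show ?thesis
      using e by (intro exI[of _ \<delta>] conjI ballI impI \<delta>(1) ml_norm_le \<delta>(2)[THEN bspec, THEN mp, THEN spec, THEN mp]) auto
  qed
qed

end

section \<open>Transfer between spaces and norms\<close>

text \<open>As the inner map is affine and the outer one linear, each derivative only has its
  arguments sent through \<open>l\<close> and its value through \<open>p\<close>. This serves for
  \<open>PF\<close> on \<open>W\<close>, for \<open>PF\<close> after \<open>K\<close> on the whole
  space, and for \<open>K\<close> after the inverse of \<open>\<psi>\<close>.\<close>

lemma Ck_family_affine_compose:
  assumes F: "Ck_family nA nB S k f D" and S: "subspace_norm S nA" and T: "subspace_norm T nT"
    and l: "\<And>u. u \<in> T \<Longrightarrow> l u \<in> S"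
    and l_lin: "\<And>u v a b. u \<in> T \<Longrightarrow> v \<in> T \<Longrightarrow> l (a *\<^sub>R u + b *\<^sub>R v) = a *\<^sub>R l u + b *\<^sub>R l v"
    and C: "C > 0" "\<And>u. u \<in> T \<Longrightarrow> nA (l u) \<le> C * nT u"
    and p: "linear p" and C': "C' > 0" "\<And>z. nC (p z) \<le> C' * nB z" and c: "c \<in> S"
  shows "Ck_family nT nC T k (\<lambda>x. p (f (l x + c))) (\<lambda>j x h. p (D j (l x + c) (\<lambda>i. l (h i))))"
  unfolding Ck_family_def
proof (intro conjI allI ballI impI)
  interpret S: subspace_norm S nA by (rule S)
  interpret T: subspace_norm T nT by (rule T)
  note F = F[unfolded Ck_family_def]
  have lc: "l x + c \<in> S" if "x \<in> T" for x using l[OF that] c subspace_add[OF S.sub] by blast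
  have ld: "(l y + c) - (l x + c) = l (y - x)" if "x \<in> T" "y \<in> T" for x y
    using l_lin[OF that(2,1), of 1 "-1"] by simp
  have prod: "(\<Prod>i<j. nA (l (h i))) \<le> C ^ j * (\<Prod>i<j. nT (h i))" if "\<forall>i<j. h i \<in> T" for j and h :: "nat \<Rightarrow> _"
  proof -
    have "(\<Prod>i<j. nA (l (h i))) \<le> (\<Prod>i<j. C * nT (h i))"
      using that C(2) by (intro prod_mono) (auto simp: S.nonneg)
    then show ?thesis by (simp add: prod.distrib)
  qed
  have upd: "(\<lambda>i. l ((h(j := w)) i)) = (\<lambda>i. l (h i))(j := l w)" for h j w
    by (auto simp: fun_eq_iff)
  note p_diff = linear_diff[OF p]
  show "p (D 0 (l x + c) (\<lambda>i. l (h i))) = p (f (l x + c))" if "x \<in> T" for x h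
    using F lc[OF that] by simp
  show "ml_bounded nT nC T j (\<lambda>h. p (D j (l x + c) (\<lambda>i. l (h i))))" if j: "j \<le> k" and x: "x \<in> T" for j x
    unfolding ml_bounded_def
  proof (intro conjI allI ballI impI)
    have M: "ml_bounded nA nB S j (D j (l x + c))" using F j lc[OF x] by blast
    note M = M[unfolded ml_bounded_def]
    show "p (D j (l x + c) (\<lambda>i. l (h i))) = p (D j (l x + c) (\<lambda>i. l (h' i)))" if "\<forall>i<j. h i = h' i" for h h'
      by (rule arg_cong[of _ _ p], rule M[THEN conjunct1, rule_format]) (simp add: that)
    show "p (D j (l x + c) (\<lambda>i'. l ((h(i := a *\<^sub>R u + b *\<^sub>R v)) i'))) =
        a *\<^sub>R p (D j (l x + c) (\<lambda>i'. l ((h(i := u)) i'))) + b *\<^sub>R p (D j (l x + c) (\<lambda>i'. l ((h(i := v)) i')))"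
      if "i < j" "u \<in> T" "v \<in> T" "\<forall>l<j. h l \<in> T" for h i u v a b
    proof -
      have "D j (l x + c) ((\<lambda>i. l (h i))(i := a *\<^sub>R l u + b *\<^sub>R l v)) =
          a *\<^sub>R D j (l x + c) ((\<lambda>i. l (h i))(i := l u)) + b *\<^sub>R D j (l x + c) ((\<lambda>i. l (h i))(i := l v))"
        by (rule M[THEN conjunct2, THEN conjunct1, rule_format]) (use that l in auto)
      then show ?thesis unfolding upd l_lin[OF that(2,3)] by (simp add: linear_add[OF p] linear_scale[OF p])
    qed
    obtain B where B: "\<And>h. (\<forall>i<j. h i \<in> S) \<Longrightarrow> nB (D j (l x + c) h) \<le> B * (\<Prod>i<j. nA (h i))"
      using M by blast
    have "nC (p (D j (l x + c) (\<lambda>i. l (h i)))) \<le> C' * \<bar>B\<bar> * C ^ j * (\<Prod>i<j. nT (h i))"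
      if h: "\<forall>i<j. h i \<in> T" for h
    proof -
      have "nC (p (D j (l x + c) (\<lambda>i. l (h i)))) \<le> C' * nB (D j (l x + c) (\<lambda>i. l (h i)))" by (rule C')
      also have "nB (D j (l x + c) (\<lambda>i. l (h i))) \<le> B * (\<Prod>i<j. nA (l (h i)))"
        using h l by (intro B) auto
      also have "\<dots> \<le> \<bar>B\<bar> * (\<Prod>i<j. nA (l (h i)))"
        by (intro mult_right_mono prod_nonneg S.nonneg) auto
      also have "\<dots> \<le> \<bar>B\<bar> * (C ^ j * (\<Prod>i<j. nT (h i)))"
        by (intro mult_left_mono prod h) auto
      finally show ?thesis using C'(1) by (simp add: mult.assoc)
    qed
    then show "\<exists>B. \<forall>h. (\<forall>i<j. h i \<in> T) \<longrightarrow>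
        nC (p (D j (l x + c) (\<lambda>i. l (h i)))) \<le> B * (\<Prod>i<j. nT (h i))" by blast
  qed
  fix j x and \<epsilon> :: real assume x: "x \<in> T" and e: "\<epsilon> > 0"
  show "\<exists>\<delta>>0. \<forall>y\<in>T. nT (y - x) < \<delta> \<longrightarrow> (\<forall>h. (\<forall>i<j. h i \<in> T) \<longrightarrow>
      nC (p (D j (l y + c) (\<lambda>i. l (h i))) - p (D j (l x + c) (\<lambda>i. l (h i))) -
        p (D (Suc j) (l x + c) (\<lambda>i. l ((h(j := y - x)) i)))) \<le> \<epsilon> * nT (y - x) * (\<Prod>i<j. nT (h i)))"
    if j: "j < k"
  proof -
    \<comment> \<open>\<open>C'\<close> comes from \<open>p\<close>, \<open>C\<close> from the
      increment and \<open>C ^ j\<close> from the \<open>j\<close> arguments.\<close>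
    define \<epsilon>' where "\<epsilon>' = \<epsilon> / (C' * C * C ^ j)"
    have e': "\<epsilon>' > 0" "C' * (\<epsilon>' * C * C ^ j) = \<epsilon>" using e C(1) C'(1) by (auto simp: \<epsilon>'_def)
    from F[THEN conjunct2, THEN conjunct2, THEN conjunct1, rule_format, OF j lc[OF x] e'(1)]
    obtain \<delta> where \<delta>: "\<delta> > 0" "\<forall>y\<in>S. nA (y - (l x + c)) < \<delta> \<longrightarrow> (\<forall>h. (\<forall>i<j. h i \<in> S) \<longrightarrow>
        nB (D j y h - D j (l x + c) h - D (Suc j) (l x + c) (h(j := y - (l x + c)))) \<le>
          \<epsilon>' * nA (y - (l x + c)) * (\<Prod>i<j. nA (h i)))"
      by (elim exE conjE) (rule that)
    show ?thesis
    proof (intro exI[of _ "\<delta> / C"] conjI ballI allI impI)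
      show "\<delta> / C > 0" using \<delta>(1) C(1) by simp
      fix y h assume y: "y \<in> T" "nT (y - x) < \<delta> / C" and h: "\<forall>i<j. h i \<in> T"
      have yx: "y - x \<in> T" using x y subspace_diff[OF T.sub] by blast
      have n: "nA (l (y - x)) \<le> C * nT (y - x)" by (rule C(2)[OF yx])
      also have "\<dots> < \<delta>" using y(2) C(1) by (simp add: field_simps)
      finally have "nA ((l y + c) - (l x + c)) < \<delta>" unfolding ld[OF x y(1)] .
      from \<delta>(2)[rule_format, OF lc[OF y(1)] this, of "\<lambda>i. l (h i)"] h l
      have "nB (D j (l y + c) (\<lambda>i. l (h i)) - D j (l x + c) (\<lambda>i. l (h i)) -
          D (Suc j) (l x + c) ((\<lambda>i. l (h i))(j := l (y - x)))) \<le> \<epsilon>' * nA (l (y - x)) * (\<Prod>i<j. nA (l (h i)))"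
        unfolding ld[OF x y(1)] by blast
      also have "\<dots> \<le> \<epsilon>' * (C * nT (y - x)) * (C ^ j * (\<Prod>i<j. nT (h i)))"
        using e'(1) C(1) n
        by (intro mult_mono prod h mult_nonneg_nonneg prod_nonneg S.nonneg T.nonneg mult_left_mono) auto
      also have "\<dots> = (\<epsilon>' * C * C ^ j) * (nT (y - x) * (\<Prod>i<j. nT (h i)))" by (simp add: mult_ac)
      finally have "C' * nB (D j (l y + c) (\<lambda>i. l (h i)) - D j (l x + c) (\<lambda>i. l (h i)) -
          D (Suc j) (l x + c) ((\<lambda>i. l (h i))(j := l (y - x))))
          \<le> C' * ((\<epsilon>' * C * C ^ j) * (nT (y - x) * (\<Prod>i<j. nT (h i))))"
        using C'(1) by (simp add: mult_left_mono)
      also have "\<dots> = \<epsilon> * nT (y - x) * (\<Prod>i<j. nT (h i))" using e'(2) by (simp add: mult.assoc[symmetric])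
      finally show "nC (p (D j (l y + c) (\<lambda>i. l (h i))) - p (D j (l x + c) (\<lambda>i. l (h i))) -
        p (D (Suc j) (l x + c) (\<lambda>i. l ((h(j := y - x)) i)))) \<le> \<epsilon> * nT (y - x) * (\<Prod>i<j. nT (h i))"
        unfolding upd p_diff[symmetric] by (rule order_trans[OF C'(2)])
    qed
  qed
  show "\<exists>\<delta>>0. \<forall>y\<in>T. nT (y - x) < \<delta> \<longrightarrow> (\<forall>h. (\<forall>i<j. h i \<in> T) \<longrightarrow>
      nC (p (D j (l y + c) (\<lambda>i. l (h i))) - p (D j (l x + c) (\<lambda>i. l (h i)))) \<le> \<epsilon> * (\<Prod>i<j. nT (h i)))"
    if j: "j \<le> k"
  proof -
    define \<epsilon>' where "\<epsilon>' = \<epsilon> / (C' * C ^ j)"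
    have e': "\<epsilon>' > 0" "C' * (\<epsilon>' * C ^ j) = \<epsilon>" using e C(1) C'(1) by (auto simp: \<epsilon>'_def)
    from F[THEN conjunct2, THEN conjunct2, THEN conjunct2, rule_format, OF j lc[OF x] e'(1)]
    obtain \<delta> where \<delta>: "\<delta> > 0" "\<forall>y\<in>S. nA (y - (l x + c)) < \<delta> \<longrightarrow> (\<forall>h. (\<forall>i<j. h i \<in> S) \<longrightarrow>
        nB (D j y h - D j (l x + c) h) \<le> \<epsilon>' * (\<Prod>i<j. nA (h i)))"
      by (elim exE conjE) (rule that)
    show ?thesis
    proof (intro exI[of _ "\<delta> / C"] conjI ballI allI impI)
      show "\<delta> / C > 0" using \<delta>(1) C(1) by simp
      fix y h assume y: "y \<in> T" "nT (y - x) < \<delta> / C" and h: "\<forall>i<j. h i \<in> T"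
      have yx: "y - x \<in> T" using x y subspace_diff[OF T.sub] by blast
      have "nA (l (y - x)) \<le> C * nT (y - x)" by (rule C(2)[OF yx])
      also have "\<dots> < \<delta>" using y(2) C(1) by (simp add: field_simps)
      finally have "nA ((l y + c) - (l x + c)) < \<delta>" unfolding ld[OF x y(1)] .
      from \<delta>(2)[rule_format, OF lc[OF y(1)] this, of "\<lambda>i. l (h i)"] h l
      have "nB (D j (l y + c) (\<lambda>i. l (h i)) - D j (l x + c) (\<lambda>i. l (h i))) \<le> \<epsilon>' * (\<Prod>i<j. nA (l (h i)))"
        by blast
      also have "\<dots> \<le> \<epsilon>' * (C ^ j * (\<Prod>i<j. nT (h i)))"
        using e'(1) by (intro mult_left_mono prod h) auto
      finally have "C' * nB (D j (l y + c) (\<lambda>i. l (h i)) - D j (l x + c) (\<lambda>i. l (h i)))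
          \<le> C' * (\<epsilon>' * (C ^ j * (\<Prod>i<j. nT (h i))))"
        using C'(1) by (simp add: mult_left_mono)
      also have "\<dots> = \<epsilon> * (\<Prod>i<j. nT (h i))" using e'(2) by (simp add: mult.assoc[symmetric])
      finally show "nC (p (D j (l y + c) (\<lambda>i. l (h i))) - p (D j (l x + c) (\<lambda>i. l (h i)))) \<le> \<epsilon> * (\<Prod>i<j. nT (h i))"
        unfolding p_diff[symmetric] by (rule order_trans[OF C'(2)])
    qed
  qed
qed

lemma tensor_iff_ml_bounded: "tensor {..<j} M \<longleftrightarrow> ml_bounded norm norm UNIV j M"
proof
  assume M: "tensor {..<j} M"
  show "ml_bounded norm norm UNIV j M"
    unfolding ml_bounded_def
  proof (intro conjI allI ballI impI)
    show "M h = M h'" if "\<forall>i<j. h i = h' i" for h h'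
      using that by (intro tensor_dep[OF M]) simp
    show "M (h(i := a *\<^sub>R u + b *\<^sub>R v)) = a *\<^sub>R M (h(i := u)) + b *\<^sub>R M (h(i := v))" if "i < j" for h i a u b v
    proof -
      have lin: "linear (\<lambda>u. M (h(i := u)))" using that by (intro tensor_linear[OF M]) simp
      show ?thesis
        using linear_add[OF lin, of "a *\<^sub>R u" "b *\<^sub>R v"] linear_scale[OF lin] by simp
    qed
    show "\<exists>B. \<forall>h. (\<forall>i<j. h i \<in> UNIV) \<longrightarrow> norm (M h) \<le> B * (\<Prod>i<j. norm (h i))"
      using tensor_boundE[OF M] unfolding tprod_def by metis
  qed
next
  assume M: "ml_bounded norm norm UNIV j M"
  note M = M[unfolded ml_bounded_def]
  obtain B where B: "\<And>h. norm (M h) \<le> B * (\<Prod>i<j. norm (h i))" using M by auto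
  show "tensor {..<j} M"
  proof (rule tensorI)
    show "norm (M h) \<le> B * tprod {..<j} h" for h using B unfolding tprod_def .
    show "M h = M h'" if "\<And>i. i \<in> {..<j} \<Longrightarrow> h i = h' i" for h h'
      by (rule M[THEN conjunct1, rule_format]) (simp add: that)
    show "linear (\<lambda>u. M (h(i := u)))" if "i \<in> {..<j}" for h i
    proof -
      have *: "M (h(i := a *\<^sub>R u + b *\<^sub>R v)) = a *\<^sub>R M (h(i := u)) + b *\<^sub>R M (h(i := v))" for a u b v
        by (rule M[THEN conjunct2, THEN conjunct1, rule_format]) (use that in auto)
      show ?thesis
      proof (rule linearI)
        show "M (h(i := u + v)) = M (h(i := u)) + M (h(i := v))" for u v using *[of 1 u 1 v] by simp
        show "M (h(i := a *\<^sub>R u)) = a *\<^sub>R M (h(i := u))" for a u using *[of a u 0 u] by simp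
      qed
    qed
  qed
qed

text \<open>The bridge between the two-norm notion and the tensor calculus, which works on the whole
  space with its own norm.\<close>

lemma Ck_family_iff_tower:
  "Ck_family norm norm UNIV k f D \<longleftrightarrow> (\<forall>x h. D 0 x h = f x) \<and> derivative_tower 0 k D"
  unfolding Ck_family_def derivative_tower_def tensor_cont_def tensor_deriv_def eventually_nhds_metric
    dist_norm tprod_def tensor_iff_ml_bounded
  by (simp add: all_conj_distrib imp_conjR conj_ac)

lemma derivative_tower_add:
  assumes "derivative_tower m k D" "derivative_tower m k E"
  shows "derivative_tower m k (\<lambda>j x h. D j x h + E j x h)"
  using assms unfolding derivative_tower_def
  by (simp add: tensor_add tensor_cont_add tensor_deriv_add)

lemma derivative_tower_linear:
  assumes l: "linear l" and C: "\<And>x. norm (l x) \<le> C * norm x"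
  shows "derivative_tower 0 k (\<lambda>j x h. if j = 0 then l x else if j = 1 then l (h 0) else 0)"
proof -
  show ?thesis
    unfolding derivative_tower_def
  proof (intro conjI allI impI)
    fix j :: nat
    have "tensor {..<j} (\<lambda>h. if j = 0 then l x else if j = 1 then l (h 0) else 0)" for x
    proof (cases "j = 0 \<or> j = 1")
      case True
      then show ?thesis
      proof
        assume "j = 0"
        then show ?thesis by (intro tensorI[where B = "norm (l x)"]) (auto simp: tprod_def)
      next
        assume "j = 1"
        then show ?thesis using l C by (intro tensorI[where B = C]) (auto simp: tprod_def)
      qed
    next
      case False
      then show ?thesis by (intro tensorI[where B = 0]) (auto simp: linear_zero)
    qed
    then show "tensor {..<0 + j} (\<lambda>h. if j = 0 then l x else if j = 1 then l (h 0) else 0)" for x by simp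
    show "tensor_cont {..<0 + j} (\<lambda>x h. if j = 0 then l x else if j = 1 then l (h 0) else 0)"
    proof (cases "j = 0")
      case True
      have "filterlim l (nhds (l x)) (nhds x)" for x
        by (rule lipschitz_filterlim_nhds[of _ C]) (use linear_diff[OF l] C in metis)
      from tendstoD[OF this] have "\<forall>\<^sub>F y in nhds x. norm (l y - l x) \<le> \<epsilon>" if "\<epsilon> > 0" for x \<epsilon>
        using that by (intro eventually_mono[OF _ less_imp_le]) (simp add: dist_norm)
      then show ?thesis unfolding tensor_cont_def by (simp add: True tprod_def)
    qed (auto simp: tensor_cont_def)
    show "tensor_deriv {..<0 + j} (0 + j) (\<lambda>x h. if j = 0 then l x else if j = 1 then l (h 0) else 0)
        (\<lambda>x h. if Suc j = 0 then l x else if Suc j = 1 then l (h 0) else 0)"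
      unfolding tensor_deriv_def using linear_diff[OF l] by auto
  qed
qed

section \<open>The reduced map\<close>

lemma linear_proj_perp: "linear (proj_perp phi)"
  by (rule linearI) (simp_all add: proj_perp_def inner_add_left scaleR_add_left scaleR_diff_right)

lemma norm_proj_perp_le:
  assumes "norm phi = 1"
  shows "norm (proj_perp phi y) \<le> norm y"
proof (rule power2_le_imp_le)
  have "inner phi phi = 1" using assms by (simp flip: power2_norm_eq_inner)
  then show "(norm (proj_perp phi y))\<^sup>2 \<le> (norm y)\<^sup>2"
    unfolding power2_norm_eq_inner proj_perp_def
    by (simp add: inner_diff_left inner_diff_right inner_commute)
qed simp

lemma Ck_on_cong:
  assumes "\<And>x. x \<in> S \<Longrightarrow> f x = g x"
  shows "Ck_on nA nB S k f \<longleftrightarrow> Ck_on nA nB S k g"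
  unfolding Ck_on_def using assms by simp

text \<open>Here \<open>t\<close> is fixed, while \<open>m\<close> and \<open>n\<close> can be
  shared by all \<open>t\<close>; constants expressed by \<open>m\<close> and \<open>n\<close> are
  therefore uniform.\<close>

locale reduced_map = symmetric_on D L
  for D :: "'a::{real_inner, complete_space} set" and L :: "'a \<Rightarrow> 'a" +
  fixes phi :: 'a and N :: "'a \<Rightarrow> 'a" and lam m n t :: real
  assumes phi: "phi \<in> D" "norm phi = 1" "L phi = lam *\<^sub>R phi"
    and img: "L ` (D \<inter> perp phi) = perp phi"
    and low: "\<And>w. w \<in> D \<inter> perp phi \<Longrightarrow> m * norm w \<le> norm (L w)"
    and nm: "0 \<le> n" "n < m"
    and lip: "n-lipschitz_on (perp phi) (\<lambda>w. proj_perp phi (N (w + t *\<^sub>R phi)))"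
begin

abbreviation "W \<equiv> D \<inter> perp phi"
abbreviation "P \<equiv> proj_perp phi"

definition "PN w = P (N (w + t *\<^sub>R phi))"
definition "PF w = P (L (w + t *\<^sub>R phi) - N (w + t *\<^sub>R phi))"
definition "K y = inv_into W L (P y)"
definition "\<psi> u = u - PN (K u)"

lemma m_pos: "m > 0"
  using nm by simp

lemma W_sub: "subspace W"
  using sub subspace_perp by (rule subspace_inter)

lemma P_perp [simp]: "inner (P y) phi = 0"
  using phi(2) by (simp add: proj_perp_def inner_diff_left flip: power2_norm_eq_inner)

lemma P_id: "y \<in> perp phi \<Longrightarrow> P y = y"
  by (simp add: proj_perp_def)

lemma L_inj: "inj_on L W"
proof (rule inj_onI)
  fix x y assume xy: "x \<in> W" "y \<in> W" "L x = L y"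
  then have "m * norm (x - y) \<le> 0"
    using low[of "x - y"] diff[of x y] subspace_diff[OF W_sub, of x y] by simp
  then show "x = y" using m_pos by (simp add: mult_le_0_iff)
qed

lemma K: "K y \<in> W" "L (K y) = P y"
proof -
  have "P y \<in> L ` W" unfolding img by simp
  then show "K y \<in> W" "L (K y) = P y" unfolding K_def by (rule inv_into_into, rule f_inv_into_f)
qed

lemma K_L: "w \<in> W \<Longrightarrow> K (L w) = w"
proof -
  assume w: "w \<in> W"
  then have "L w \<in> perp phi" using img by blast
  then show ?thesis unfolding K_def by (simp only: P_id inv_into_f_f[OF L_inj w])
qed

lemma K_linear: "linear K"
proof -
  have *: "K y = w" if "w \<in> W" "L w = P y" for y w
    using K[of y] that inj_onD[OF L_inj] by metis
  show ?thesis
  proof (rule linearI)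
    show "K (x + y) = K x + K y" for x y
      using K add[of "K x" "K y"]
      by (intro * subspace_add[OF W_sub]) (auto simp: linear_add[OF linear_proj_perp])
    show "K (c *\<^sub>R x) = c *\<^sub>R K x" for c x
      using K scale[of "K x" c]
      by (intro * subspace_scale[OF W_sub]) (auto simp: linear_scale[OF linear_proj_perp])
  qed
qed

lemma K_bound: "norm (K y) \<le> 1 / m * norm y"
proof -
  have "m * norm (K y) \<le> norm y"
    using low[OF K(1), of y] norm_proj_perp_le[OF phi(2), of y] unfolding K(2) by (rule order_trans)
  then show ?thesis using m_pos by (simp add: field_simps)
qed

lemma K_graph_bound: "graph_norm L (K y) \<le> (1 / m + 1) * norm y"
  using K_bound[of y] norm_proj_perp_le[OF phi(2), of y]
  by (simp add: graph_norm_def K(2) distrib_right)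

text \<open>\<open>P\<close> kills \<open>L (t *\<^sub>R phi)\<close>, a multiple of the
  eigenvector, so the linear part does not depend on \<open>t\<close>.\<close>

lemma PF_eq: "w \<in> W \<Longrightarrow> PF w = L w - PN w"
proof -
  assume w: "w \<in> W"
  have Lw: "P (L w) = L w" using w img by (intro P_id) blast
  have "inner phi phi = 1" using phi(2) by (simp flip: power2_norm_eq_inner)
  then have "P phi = 0" by (simp add: proj_perp_def)
  moreover have "L (w + t *\<^sub>R phi) = L w + (t * lam) *\<^sub>R phi"
    using w phi add[of w "t *\<^sub>R phi"] scale[of phi t] closed_ops(3)[of phi t] by simp
  ultimately show ?thesis
    unfolding PF_def PN_def
    by (simp add: linear_diff[OF linear_proj_perp] linear_add[OF linear_proj_perp]
        linear_scale[OF linear_proj_perp] Lw)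
qed

lemma PF_psi: "w \<in> W \<Longrightarrow> PF w = \<psi> (L w)"
  by (simp only: PF_eq \<psi>_def K_L)

lemma PN_lip: "w1 \<in> perp phi \<Longrightarrow> w2 \<in> perp phi \<Longrightarrow> norm (PN w1 - PN w2) \<le> n * norm (w1 - w2)"
  using lipschitz_onD[OF lip] unfolding PN_def dist_norm by blast

lemma psi_near: "norm ((y - \<psi> y) - (x - \<psi> x)) \<le> n / m * norm (y - x)"
proof -
  have "norm (PN (K y) - PN (K x)) \<le> n * norm (K (y - x))"
    using PN_lip[of "K y" "K x"] K(1) by (simp add: linear_diff[OF K_linear])
  also have "\<dots> \<le> n * (1 / m * norm (y - x))"
    using nm(1) by (intro mult_left_mono K_bound)
  finally show ?thesis by (simp add: \<psi>_def)
qed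

lemma q: "0 \<le> n / m" "n / m < 1"
  using nm by (auto simp: field_simps)

lemma psi_bij: "bij \<psi>"
  using near_identity_bij(1)[OF q psi_near] .

lemma psi_lower: "(1 - n / m) * norm (y - x) \<le> norm (\<psi> y - \<psi> x)"
  using near_identity_bij(2)[OF q psi_near] .

text \<open>\<open>PN\<close> takes values orthogonal to \<open>phi\<close>, so
  \<open>\<psi>\<close> keeps the component along \<open>phi\<close>; its bijectivity therefore
  restricts to the complement.\<close>

lemma psi_perp_iff: "\<psi> u \<in> perp phi \<longleftrightarrow> u \<in> perp phi"
  by (simp add: \<psi>_def PN_def inner_diff_left)

lemma psi_perp: "\<psi> ` perp phi = perp phi"
proof (intro equalityI subsetI)
  fix y assume "y \<in> \<psi> ` perp phi"
  then obtain u where "u \<in> perp phi" "y = \<psi> u" by (rule imageE)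
  then show "y \<in> perp phi" by (simp only: psi_perp_iff)
next
  fix y assume y: "y \<in> perp phi"
  obtain u where u: "y = \<psi> u" using psi_bij by (metis bij_pointE)
  have "u \<in> perp phi" using y unfolding u by (simp only: psi_perp_iff)
  then show "y \<in> \<psi> ` perp phi" using u by (rule rev_image_eqI)
qed

lemma PF_bij: "bij_betw PF W (perp phi)"
proof -
  have "bij_betw L W (perp phi)" using L_inj img by (simp add: bij_betw_def)
  moreover have "bij_betw \<psi> (perp phi) (perp phi)"
    using psi_perp inj_on_subset[OF bij_is_inj[OF psi_bij] subset_UNIV] by (simp add: bij_betw_def)
  ultimately have "bij_betw (\<psi> \<circ> L) W (perp phi)" by (rule bij_betw_trans)
  then show ?thesis
    by (rule iffD1[OF bij_betw_cong, rotated]) (simp only: PF_psi o_apply)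
qed

lemma PF_inv:
  assumes "y \<in> perp phi"
  shows "the_inv_into W PF y = K (inv \<psi> y)"
proof (rule the_inv_into_f_eq)
  show "inj_on PF W" using PF_bij by (rule bij_betw_imp_inj_on)
  have psi: "\<psi> (inv \<psi> y) = y" using psi_bij by (simp add: bij_is_surj surj_f_inv_f)
  then have "inv \<psi> y \<in> perp phi" using psi_perp_iff assms by metis
  then have "L (K (inv \<psi> y)) = inv \<psi> y" unfolding K(2) by (rule P_id)
  then show "PF (K (inv \<psi> y)) = y" unfolding PF_psi[OF K(1)] by (simp only: psi)
qed (rule K(1))

lemma PF_lipschitz:
  assumes "w1 \<in> W" "w2 \<in> W"
  shows "norm (PF w1 - PF w2) \<le> (1 + n) * graph_norm L (w1 - w2)"
proof -
  have "PF w1 - PF w2 = L (w1 - w2) - (PN w1 - PN w2)"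
    using assms by (simp add: PF_eq diff)
  then have "norm (PF w1 - PF w2) \<le> norm (L (w1 - w2)) + norm (PN w1 - PN w2)"
    using norm_triangle_ineq4 by metis
  also have "\<dots> \<le> norm (L (w1 - w2)) + n * norm (w1 - w2)"
    using PN_lip[of w1 w2] assms by simp
  also have "\<dots> \<le> (1 + n) * norm (L (w1 - w2)) + (1 + n) * norm (w1 - w2)"
    using nm(1) by (intro add_mono) (simp_all add: distrib_right)
  finally show ?thesis by (simp add: graph_norm_def distrib_left add.commute)
qed

text \<open>One factor is the bound of \<open>K\<close> into the graph norm, the other the Lipschitz
  constant of the inverse of \<open>\<psi>\<close>.\<close>

lemma PF_inv_lipschitz:
  assumes y: "y1 \<in> perp phi" "y2 \<in> perp phi"
  shows "graph_norm L (the_inv_into W PF y1 - the_inv_into W PF y2)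
    \<le> (1 / m + 1) * (1 / (1 - n / m)) * norm (y1 - y2)"
proof -
  have "graph_norm L (the_inv_into W PF y1 - the_inv_into W PF y2) \<le> (1 / m + 1) * norm (inv \<psi> y1 - inv \<psi> y2)"
    unfolding PF_inv[OF y(1)] PF_inv[OF y(2)] linear_diff[OF K_linear, symmetric] by (rule K_graph_bound)
  also have "\<dots> \<le> (1 / m + 1) * (1 / (1 - n / m) * norm (y1 - y2))"
  proof (rule mult_left_mono)
    have "(1 - n / m) * norm (inv \<psi> y1 - inv \<psi> y2) \<le> norm (y1 - y2)"
      using psi_lower[of "inv \<psi> y1" "inv \<psi> y2"] by (simp add: bij_is_surj[OF psi_bij] surj_f_inv_f)
    moreover have "1 - n / m > 0" using q(2) by simp
    ultimately show "norm (inv \<psi> y1 - inv \<psi> y2) \<le> 1 / (1 - n / m) * norm (y1 - y2)"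
      by (simp add: pos_le_divide_eq mult.commute)
  qed (use m_pos in simp)
  finally show ?thesis by (simp only: mult.assoc)
qed

lemma subspace_norm_graph: "subspace T \<Longrightarrow> T \<subseteq> D \<Longrightarrow> subspace_norm T (graph_norm L)"
proof unfold_locales
  assume T: "T \<subseteq> D"
  show "graph_norm L (c *\<^sub>R x) = \<bar>c\<bar> * graph_norm L x" if "x \<in> T" for c x
    using scale[of x c] T that by (auto simp: graph_norm_def distrib_left)
  show "x = 0" if "graph_norm L x = 0" for x
    using that by (simp add: graph_norm_def add_nonneg_eq_0_iff)
qed (auto simp: graph_norm_def)

lemma subspace_norm_norm: "subspace T \<Longrightarrow> subspace_norm T (norm :: 'a \<Rightarrow> real)"
  by unfold_locales auto

theorem PF_diffeo:
  assumes k: "k \<ge> 1" and F: "Ck_on (graph_norm L) norm D k (\<lambda>x. L x - N x)"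
  shows "Ck_diffeo (graph_norm L) norm W (perp phi) k PF"
proof -
  interpret XD: subspace_norm D "graph_norm L" by (rule subspace_norm_graph[OF sub subset_refl])
  interpret XW: subspace_norm W "graph_norm L" by (rule subspace_norm_graph[OF W_sub Int_lower1])
  interpret YU: subspace_norm UNIV "norm :: 'a \<Rightarrow> real" by (rule subspace_norm_norm[OF subspace_UNIV])
  interpret YH: subspace_norm "perp phi" "norm :: 'a \<Rightarrow> real" by (rule subspace_norm_norm[OF subspace_perp])
  obtain E where E: "Ck_family (graph_norm L) norm D k (\<lambda>x. L x - N x) E"
    by (rule XD.Ck_on_family[OF F])
  have tphi: "t *\<^sub>R phi \<in> D" using phi(1) by (rule closed_ops(3))
  have norm_P: "norm (P z) \<le> 1 * norm z" for z using norm_proj_perp_le[OF phi(2)] by simp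
  have Cm: "1 / m + 1 > 0" using m_pos by (simp add: add_pos_pos)
  have "Ck_family (graph_norm L) norm W k PF (\<lambda>j x h. P (E j (x + t *\<^sub>R phi) (\<lambda>i. h i)))"
    unfolding PF_def
    by (rule Ck_family_affine_compose[OF E XD.subspace_norm_axioms XW.subspace_norm_axioms,
          where l = "\<lambda>x. x" and C = 1 and p = P and C' = 1 and c = "t *\<^sub>R phi"])
      (use linear_proj_perp norm_P tphi in auto)
  then have PF_Ck: "Ck_on (graph_norm L) norm W k PF" by (rule XW.Ck_family_Ck_on)
  have "\<exists>G. Ck_family norm norm UNIV k (\<lambda>u. PF (K u)) G"
    unfolding PF_def
    by (rule exI, rule Ck_family_affine_compose[OF E XD.subspace_norm_axioms YU.subspace_norm_axioms,
          where l = K and C = "1 / m + 1" and p = P and C' = 1 and c = "t *\<^sub>R phi"])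
      (use linear_proj_perp norm_P tphi K(1) Cm K_graph_bound in
        \<open>auto simp: linear_add[OF K_linear] linear_scale[OF K_linear]\<close>)
  then obtain G where G: "derivative_tower 0 k G" "\<And>u h. G 0 u h = PF (K u)"
    unfolding Ck_family_iff_tower by blast
  have "norm (u - P u) \<le> 1 * norm u" for u
    using phi(2) Cauchy_Schwarz_ineq2[of u phi] by (simp add: proj_perp_def)
  moreover have "linear (\<lambda>u. u - P u)"
    by (intro linear_compose_sub linear_proj_perp linear_ident)
  ultimately have I: "derivative_tower 0 k (\<lambda>j x h. if j = 0 then x - P x else if j = 1 then h 0 - P (h 0) else 0)"
    by (rule derivative_tower_linear[rotated])
  \<comment> \<open>\<open>PF (K u)\<close> equals \<open>P u - PN (K u)\<close>; adding the linear
    map \<open>u - P u\<close> gives \<open>\<psi> u\<close>.\<close>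
  have T: "derivative_tower 0 k (\<lambda>j x h. G j x h + (if j = 0 then x - P x else if j = 1 then h 0 - P (h 0) else 0))"
    by (rule derivative_tower_add[OF G(1) I])
  have T0: "G 0 x h + (if (0::nat) = 0 then x - P x else if (0::nat) = 1 then h 0 - P (h 0) else 0) = \<psi> x" for x h
    by (simp add: G(2) PF_eq[OF K(1)] K(2) \<psi>_def)
  have psi_inv: "\<psi> (inv \<psi> y) = y" for y using psi_bij by (simp add: bij_is_surj surj_f_inv_f)
  \<comment> \<open>\<open>k >= 1\<close> is essential: inverting \<open>\<psi>\<close> uses its
    first derivative.\<close>
  obtain k' where k': "k = Suc k'" using k by (cases k) auto
  obtain I where "derivative_tower 0 k I" "\<And>x h. I 0 x h = inv \<psi> x"
    using derivative_tower_inverse[OF T[unfolded k'] T0 psi_inv q psi_near] unfolding k' by blast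
  then have "Ck_family norm norm UNIV k (inv \<psi>) I" unfolding Ck_family_iff_tower by blast
  then have "Ck_family norm (graph_norm L) (perp phi) k (\<lambda>y. K (inv \<psi> (y + 0))) (\<lambda>j x h. K (I j (x + 0) (\<lambda>i. h i)))"
    by (rule Ck_family_affine_compose[OF _ YU.subspace_norm_axioms YH.subspace_norm_axioms,
          where l = "\<lambda>x. x" and C = 1 and p = K and C' = "1 / m + 1" and c = 0])
      (use K_linear Cm K_graph_bound in auto)
  from YH.Ck_family_Ck_on[OF this] have "Ck_on norm (graph_norm L) (perp phi) k (the_inv_into W PF)"
    by (rule iffD1[OF Ck_on_cong, rotated]) (simp only: PF_inv add_0_right)
  then show ?thesis unfolding Ck_diffeo_def using PF_bij PF_Ck by blast
qed

end

theorem theorem3: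
  fixes D :: "'a::{real_inner, complete_space} set"
    and L N :: "'a \<Rightarrow> 'a" and lam_p :: real and phi_p :: 'a and n :: real
  assumes SA: "self_adjoint_op D L"
    and EV: "simple_isolated_eigenvalue D L lam_p phi_p"
    and n_nonneg: "n \<ge> 0"
    and Lip: "\<forall>t::real. n-lipschitz_on {y. inner y phi_p = 0}
                 (\<lambda>w. proj_perp phi_p (N (w + t *\<^sub>R phi_p)))"
    and gap: "{-n..n} \<inter> spectrum_op D L = {lam_p}"
  shows "(\<exists>C1 C2. C1 \<ge> 0 \<and> C2 \<ge> 0 \<and> (\<forall>t::real.
            bij_betw (\<lambda>w. proj_perp phi_p (L (w + t *\<^sub>R phi_p) - N (w + t *\<^sub>R phi_p)))
               (D \<inter> {y. inner y phi_p = 0}) {y. inner y phi_p = 0} \<and>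
            (\<forall>w1\<in>D \<inter> {y. inner y phi_p = 0}. \<forall>w2\<in>D \<inter> {y. inner y phi_p = 0}.
               norm (proj_perp phi_p (L (w1 + t *\<^sub>R phi_p) - N (w1 + t *\<^sub>R phi_p))
                     - proj_perp phi_p (L (w2 + t *\<^sub>R phi_p) - N (w2 + t *\<^sub>R phi_p)))
               \<le> C1 * graph_norm L (w1 - w2)) \<and>
            (\<forall>y1\<in>{y. inner y phi_p = 0}. \<forall>y2\<in>{y. inner y phi_p = 0}.
               graph_norm L
                 (the_inv_into (D \<inter> {y. inner y phi_p = 0})
                    (\<lambda>w. proj_perp phi_p (L (w + t *\<^sub>R phi_p) - N (w + t *\<^sub>R phi_p))) y1
                  - the_inv_into (D \<inter> {y. inner y phi_p = 0})
                    (\<lambda>w. proj_perp phi_p (L (w + t *\<^sub>R phi_p) - N (w + t *\<^sub>R phi_p))) y2)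
               \<le> C2 * norm (y1 - y2))))
         \<and> (\<forall>k\<ge>1. Ck_on (graph_norm L) norm D k (\<lambda>x. L x - N x) \<longrightarrow>
              (\<forall>t::real. Ck_diffeo (graph_norm L) norm (D \<inter> {y. inner y phi_p = 0})
                 {y. inner y phi_p = 0} k
                 (\<lambda>w. proj_perp phi_p (L (w + t *\<^sub>R phi_p) - N (w + t *\<^sub>R phi_p)))))"
proof -
  note EV' = EV[unfolded simple_isolated_eigenvalue_def]
  interpret symmetric_on D L using SA by (rule self_adjoint_symmetric_on)
  obtain m where m: "m > n" "\<forall>w\<in>D \<inter> perp phi_p. m * norm w \<le> norm (L w)"
    and img: "L ` (D \<inter> perp phi_p) = perp phi_p"
    using self_adjoint_perp_gap[OF SA EV n_nonneg gap] by (elim conjE exE) (rule that)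
  have R: "reduced_map D L phi_p N lam_p m n t" for t
  proof unfold_locales
    show "n-lipschitz_on (perp phi_p) (\<lambda>w. proj_perp phi_p (N (w + t *\<^sub>R phi_p)))" using Lip by (rule spec)
  qed (use EV' n_nonneg m in \<open>simp_all add: img\<close>)
  note PF = reduced_map.PF_def[OF R, abs_def]
  \<comment> \<open>\<open>m\<close> was obtained before \<open>t\<close>, so both constants serve
    for every \<open>t\<close>.\<close>
  have C: "1 + n \<ge> 0" "(1 / m + 1) * (1 / (1 - n / m)) \<ge> 0"
    using n_nonneg m(1) by (auto intro!: mult_nonneg_nonneg)
  show ?thesis
    by (rule conjI, rule exI[of _ "1 + n"], rule exI[of _ "(1 / m + 1) * (1 / (1 - n / m))"])
      (intro conjI allI ballI impI C reduced_map.PF_bij[OF R, unfolded PF]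
        reduced_map.PF_lipschitz[OF R, unfolded PF] reduced_map.PF_inv_lipschitz[OF R, unfolded PF]
        reduced_map.PF_diffeo[OF R, unfolded PF]; assumption)+
qed

end
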